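(* For $i=1,2$, let $G_i$ be a nilpotent group, let $S_i$ be a symmetric finite generating set of $G_i$, and let $N_i$ be the torsion subgroup of $G_i$ (the set of all elements of finite order, a finite normal subgroup). Let $\varphi$ be a graph isomorphism from $\mathrm{Cay}(G_1;S_1)$ to $\mathrm{Cay}(G_2;S_2)$. Then $\varphi$ induces a well-defined map $\overline\varphi\colon G_1/N_1\to G_2/N_2$, $\overline\varphi(xN_1)=\varphi(x)N_2$, and $\overline\varphi$ is an affine bijection.
   Context: For a group $G$ and a symmetric subset $S$ ($S=S^{-1}$), $\mathrm{Cay}(G;S)$ is the graph with vertex set $G$ in which $g$ is adjacent to $gs$ for all $g\in G$, $s\in S$. A map $\psi\colon H_1\to H_2$ between groups is an affine bijection if there exist a group isomorphism $\alpha\colon H_1\to H_2$ and $h\in H_2$ with $\psi(x)=h\,\alpha(x)$ for all $x\in H_1$. *)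

theory Defs
  imports "HOL-Algebra.Generated_Groups" "Graph_Theory.Pair_Digraph"
begin

text \<open>The term with index \<open>n\<close> is \<open>\<gamma>\<^sub>n\<^sub>+\<^sub>1(G)\<close>, i.e. the series starts at index 0 with \<open>G\<close> itself.\<close>

primrec lower_central_series :: "('a, 'b) monoid_scheme \<Rightarrow> nat \<Rightarrow> 'a set" where
  "lower_central_series G 0 = carrier G"
| "lower_central_series G (Suc n) =
     generate G (\<Union>x \<in> lower_central_series G n. \<Union>g \<in> carrier G.
       {x \<otimes>\<^bsub>G\<^esub> g \<otimes>\<^bsub>G\<^esub> inv\<^bsub>G\<^esub> x \<otimes>\<^bsub>G\<^esub> inv\<^bsub>G\<^esub> g})"

definition nilpotent_group :: "('a, 'b) monoid_scheme \<Rightarrow> bool" where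
  "nilpotent_group G \<longleftrightarrow> group G \<and> (\<exists>n. lower_central_series G n = {\<one>\<^bsub>G\<^esub>})"

definition torsion_subgroup :: "('a, 'b) monoid_scheme \<Rightarrow> 'a set" where
  "torsion_subgroup G = {x \<in> carrier G. \<exists>n::nat. n > 0 \<and> x [^]\<^bsub>G\<^esub> n = \<one>\<^bsub>G\<^esub>}"

definition symmetric_finite_generating_set :: "('a, 'b) monoid_scheme \<Rightarrow> 'a set \<Rightarrow> bool" where
  "symmetric_finite_generating_set G S \<longleftrightarrow>
     S \<subseteq> carrier G \<and> finite S \<and> set_inv\<^bsub>G\<^esub> S = S \<and> generate G S = carrier G"

text \<open>An undirected graph is represented by its vertex set and its adjacency relation; the
  relation below is symmetric when \<open>S\<close> is. There is a loop at every vertex if \<open>\<one> \<in> S\<close>.\<close>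

definition Cay :: "('a, 'b) monoid_scheme \<Rightarrow> 'a set \<Rightarrow> 'a pair_pre_digraph" where
  "Cay G S = \<lparr>pverts = carrier G, parcs = {(g, g \<otimes>\<^bsub>G\<^esub> s) | g s. g \<in> carrier G \<and> s \<in> S}\<rparr>"

text \<open>The isomorphisms of \<open>Digraph_Isomorphism\<close> carry a separate map on arcs; here there are no
  parallel arcs, so an isomorphism is just a map on vertices.\<close>

definition graph_isomorphism ::
    "'a pair_pre_digraph \<Rightarrow> 'b pair_pre_digraph \<Rightarrow> ('a \<Rightarrow> 'b) \<Rightarrow> bool" where
  "graph_isomorphism X Y f \<longleftrightarrow>
     bij_betw f (pverts X) (pverts Y) \<and>
     (\<forall>u \<in> pverts X. \<forall>v \<in> pverts X. (u, v) \<in> parcs X \<longleftrightarrow> (f u, f v) \<in> parcs Y)"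

definition affine_bijection ::
    "('a, 'c) monoid_scheme \<Rightarrow> ('b, 'd) monoid_scheme \<Rightarrow> ('a \<Rightarrow> 'b) \<Rightarrow> bool" where
  "affine_bijection H1 H2 f \<longleftrightarrow>
     (\<exists>\<alpha> \<in> iso H1 H2. \<exists>h \<in> carrier H2. \<forall>x \<in> carrier H1. f x = h \<otimes>\<^bsub>H2\<^esub> \<alpha> x)"

end

theory Submission
  imports Defs "HOL-Algebra.Zassenhaus" "HOL-Algebra.FiniteProduct"
begin

text \<open>
  Let \<open>K\<^sub>0 = N\<close> be the torsion subgroup of \<open>G\<close> and let \<open>K\<^sub>i\<^sub>+\<^sub>1\<close> be the preimage of the centre of
  \<open>G/K\<^sub>i\<close>; all quotients \<open>G/K\<^sub>i\<close> are torsion-free, and \<open>K\<^sub>n = G\<close> for some \<open>n\<close>.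

  The key point is that an automorphism \<open>\<psi>\<close> of the Cayley graph for which \<open>c(x) = x\<^sup>-\<^sup>1 \<psi>(x)\<close> takes
  only finitely many values modulo \<open>K\<^sub>i\<close> has \<open>c\<close> constant modulo \<open>K\<^sub>i\<close>, with value in \<open>K\<^sub>i\<^sub>+\<^sub>1\<close>. Going
  down from \<open>K\<^sub>n\<close>, suppose that \<open>c\<close> is a constant \<open>e\<close> modulo \<open>K\<^sub>j\<^sub>+\<^sub>1\<close>. Conjugation by \<open>e\<close> permutes the
  finite set \<open>S\<close> modulo \<open>K\<^sub>j\<^sub>+\<^sub>1\<close>, so a power of \<open>e\<close>, and hence \<open>e\<close> itself, is central there. It follows
  that \<open>e\<^sup>-\<^sup>1 c(x)\<close> is a harmonic function with finitely many values in the torsion-free abelian group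
  \<open>K\<^sub>j\<^sub>+\<^sub>1/K\<^sub>j\<close>, and the maximum principle at an extreme value shows that it is constant.

  Applied to \<open>\<phi> L\<^sub>g \<phi>\<^sup>-\<^sup>1\<close>, where \<open>L\<^sub>g\<close> is the left translation by an element \<open>g\<close> of \<open>N\<^sub>1\<close> or of the next
  term of the series, this shows successively that \<open>\<phi>\<close> maps cosets of each term to cosets of the
  corresponding term, and that right translation by \<open>g \<in> K\<^sub>i\<^sub>+\<^sub>1\<close> becomes a right translation modulo
  \<open>K\<^sub>i\<close>. A counting argument in \<open>K\<^sub>i\<^sub>+\<^sub>1/K\<^sub>i\<close> then improves \<open>\<phi>(xs) \<in> \<phi>(x) t K\<^sub>i\<^sub>+\<^sub>1\<close> for all \<open>x\<close> to
  \<open>\<phi>(xs) \<in> \<phi>(x) t' K\<^sub>i\<close> for all \<open>x\<close>, down to \<open>i = 0\<close>, which says that \<open>\<phi>\<close> is affine modulo torsion.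
\<close>

section \<open>Quotient homomorphisms, commutators and induction over words\<close>

text \<open>Obtaining \<open>Q\<close> and \<open>p\<close> instead of naming \<open>G Mod H\<close>
  hides that elements of the quotient are sets, so that simplification stays within group
  identities.\<close>

lemma (in normal) quotient_hom:
  obtains Q :: "'a set monoid" and p where
    "group_hom G Q p" "p ` carrier G = carrier Q"
    "\<And>x. x \<in> carrier G \<Longrightarrow> p x = \<one>\<^bsub>Q\<^esub> \<longleftrightarrow> x \<in> H"
    "\<And>x y. x \<in> carrier G \<Longrightarrow> y \<in> carrier G \<Longrightarrow> p x = p y \<longleftrightarrow> inv x \<otimes> y \<in> H"
proof -
  let ?p = "\<lambda>x. H #> x"
  have gh: "group_hom G (G Mod H) ?p"
    by (simp add: group_hom_def group_hom_axioms_def factorgroup_is_group r_coset_hom_Mod)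
  interpret p: group_hom G "G Mod H" ?p by (rule gh)
  have one: "?p x = \<one>\<^bsub>G Mod H\<^esub> \<longleftrightarrow> x \<in> H" if "x \<in> carrier G" for x
    using that coset_join1[of H x] coset_join2[of x H] subset subgroup_axioms by auto
  have "?p x = ?p y \<longleftrightarrow> inv x \<otimes> y \<in> H" if "x \<in> carrier G" "y \<in> carrier G" for x y
  proof -
    have "?p x = ?p y \<longleftrightarrow> inv\<^bsub>G Mod H\<^esub> ?p x \<otimes>\<^bsub>G Mod H\<^esub> ?p y = \<one>\<^bsub>G Mod H\<^esub>"
      using that by (metis p.hom_closed p.H.inv_equality p.H.inv_inv p.H.inv_closed p.H.l_inv)
    also have "\<dots> \<longleftrightarrow> ?p (inv x \<otimes> y) = \<one>\<^bsub>G Mod H\<^esub>"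
      using that by (simp del: mult_FactGroup one_FactGroup)
    also have "\<dots> \<longleftrightarrow> inv x \<otimes> y \<in> H" using that by (intro one) simp
    finally show ?thesis .
  qed
  then show thesis
    using that[OF gh] one by (simp add: carrier_FactGroup)
qed

lemma (in group) commutator_eq_one_iff:
  assumes "x \<in> carrier G" "y \<in> carrier G"
  shows "x \<otimes> y \<otimes> inv x \<otimes> inv y = \<one> \<longleftrightarrow> x \<otimes> y = y \<otimes> x"
proof -
  have "x \<otimes> y \<otimes> inv x \<otimes> inv y = (x \<otimes> y) \<otimes> inv (y \<otimes> x)"
    using assms by (simp add: inv_mult_group m_assoc)
  then show ?thesis
    using assms by (metis inv_closed inv_inv inv_equality m_closed r_inv)
qed

lemma (in group) generate_induct_right:
  assumes S: "S \<subseteq> carrier G" "set_inv S = S" and g: "g \<in> generate G S"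
    and one: "P \<one>"
    and step: "\<And>h s. h \<in> carrier G \<Longrightarrow> s \<in> S \<Longrightarrow> P h \<Longrightarrow> P (h \<otimes> s)"
  shows "P g"
proof -
  have Sinv: "inv s \<in> S" if "s \<in> S" for s
    using S(2) that unfolding SET_INV_def by blast
  \<comment> \<open>With an arbitrary starting point \<open>h\<close>, the product case of
    \<open>generate\<close> is the composition of its two hypotheses; symmetry of \<open>S\<close>
    turns the inverse case into one more use of \<open>step\<close>.\<close>
  have "\<forall>h\<in>carrier G. P h \<longrightarrow> P (h \<otimes> g)"
    using g
  proof induct
    case (inv s)
    then show ?case using step Sinv by blast
  next
    case (eng a b)
    then have "a \<in> carrier G" "b \<in> carrier G"
      using generate_in_carrier[OF S(1)] by auto
    with eng show ?case by (metis m_assoc m_closed)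
  qed (auto simp: step)
  then show ?thesis
    using one generate_in_carrier[OF S(1) g] by (metis l_one one_closed)
qed

section \<open>Central series\<close>

text \<open>For normal \<open>K\<close> this is the preimage in \<open>G\<close> of the centre of
  \<open>G/K\<close>. The commutator form makes sense, and is monotone in \<open>K\<close>, before
  normality is known.\<close>

definition central_modulo :: "('a, 'b) monoid_scheme \<Rightarrow> 'a set \<Rightarrow> 'a set" where
  "central_modulo G K = {g \<in> carrier G. \<forall>x \<in> carrier G.
     g \<otimes>\<^bsub>G\<^esub> x \<otimes>\<^bsub>G\<^esub> inv\<^bsub>G\<^esub> g \<otimes>\<^bsub>G\<^esub> inv\<^bsub>G\<^esub> x \<in> K}"

text \<open>For normal \<open>K\<close>, these are the preimages of the upper central series of
  \<open>G/K\<close>; used for \<open>K = {\<one>}\<close> and for the torsion subgroup.\<close>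

primrec upper_central_series :: "('a, 'b) monoid_scheme \<Rightarrow> 'a set \<Rightarrow> nat \<Rightarrow> 'a set" where
  "upper_central_series G K 0 = K"
| "upper_central_series G K (Suc n) = central_modulo G (upper_central_series G K n)"

context group
begin

text \<open>The identity \<open>x h x^-1 = h [h^-1, x]\<close> writes a conjugate as a product of
  two elements of \<open>K\<close>.\<close>

lemma normal_if_commutators_mem:
  assumes K: "subgroup K G" and comm: "K \<subseteq> central_modulo G K"
  shows "K \<lhd> G"
proof (rule normal_inv_iff[THEN iffD2], rule conjI[OF K], intro ballI)
  fix x h assume x: "x \<in> carrier G" and h: "h \<in> K"
  then have hc: "h \<in> carrier G" using subgroup.subset[OF K] by auto
  have "inv h \<in> K" by (rule subgroup.m_inv_closed[OF K h])
  then have "inv h \<otimes> x \<otimes> inv (inv h) \<otimes> inv x \<in> K"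
    using comm x unfolding central_modulo_def by blast
  with h have "h \<otimes> (inv h \<otimes> x \<otimes> inv (inv h) \<otimes> inv x) \<in> K"
    by (rule subgroup.m_closed[OF K])
  moreover have "h \<otimes> (inv h \<otimes> x \<otimes> inv (inv h) \<otimes> inv x) = x \<otimes> h \<otimes> inv x"
    using x hc by (simp add: m_assoc[symmetric])
  ultimately show "x \<otimes> h \<otimes> inv x \<in> K" by simp
qed

lemma normal_subset_central_modulo:
  assumes "K \<lhd> G" shows "K \<subseteq> central_modulo G K"
proof
  fix k assume k: "k \<in> K"
  interpret K: normal K G by fact
  have "k \<otimes> (x \<otimes> inv k \<otimes> inv x) \<in> K" if "x \<in> carrier G" for x
    using k that K.inv_op_closed2 K.m_closed K.m_inv_closed by blast
  then show "k \<in> central_modulo G K"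
    using k by (auto simp: central_modulo_def m_assoc)
qed

lemma central_modulo_mono: "K \<subseteq> L \<Longrightarrow> central_modulo G K \<subseteq> central_modulo G L"
  unfolding central_modulo_def by blast

lemma subgroup_normal_if_central:
  assumes "subgroup M G" "K \<subseteq> M" "M \<subseteq> central_modulo G K"
  shows "M \<lhd> G"
  by (rule normal_if_commutators_mem[OF assms(1) order_trans[OF assms(3) central_modulo_mono[OF assms(2)]]])

text \<open>This is the preimage of the centralizer of \<open>p x\<close> in the quotient. Being a
  subgroup, it allows centrality modulo \<open>K\<close> to be tested on generators.\<close>

lemma centralizer_modulo_subgroup:
  assumes "K \<lhd> G" and x: "x \<in> carrier G"
  shows "subgroup {y \<in> carrier G. x \<otimes> y \<otimes> inv x \<otimes> inv y \<in> K} G"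
proof -
  interpret K: normal K G by fact
  obtain Q :: "'a set monoid" and p where "group_hom G Q p"
    and ker: "\<And>x. x \<in> carrier G \<Longrightarrow> p x = \<one>\<^bsub>Q\<^esub> \<longleftrightarrow> x \<in> K"
    using K.quotient_hom by metis
  then interpret p: group_hom G Q p by simp
  have eq: "x \<otimes> y \<otimes> inv x \<otimes> inv y \<in> K \<longleftrightarrow> p x \<otimes>\<^bsub>Q\<^esub> p y = p y \<otimes>\<^bsub>Q\<^esub> p x"
    if "y \<in> carrier G" for y
    using that x ker[of "x \<otimes> y \<otimes> inv x \<otimes> inv y"] p.H.commutator_eq_one_iff[of "p x" "p y"] by simp
  show ?thesis
  proof (rule subgroupI)
    show "{y \<in> carrier G. x \<otimes> y \<otimes> inv x \<otimes> inv y \<in> K} \<noteq> {}"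
      using x K.one_closed by (auto intro!: exI[of _ \<one>])
  next
    fix a assume "a \<in> {y \<in> carrier G. x \<otimes> y \<otimes> inv x \<otimes> inv y \<in> K}"
    then have a: "a \<in> carrier G" "p x \<otimes>\<^bsub>Q\<^esub> p a = p a \<otimes>\<^bsub>Q\<^esub> p x" using eq by auto
    then have "p x \<otimes>\<^bsub>Q\<^esub> p (inv a) = p (inv a) \<otimes>\<^bsub>Q\<^esub> p x"
      using x by (metis p.H.inv_solve_left' p.H.inv_solve_right' p.H.m_assoc p.H.m_closed
          p.H.inv_closed p.hom_closed p.hom_inv)
    with a show "inv a \<in> {y \<in> carrier G. x \<otimes> y \<otimes> inv x \<otimes> inv y \<in> K}" using eq[of "inv a"] by auto
  next
    fix a b assume "a \<in> {y \<in> carrier G. x \<otimes> y \<otimes> inv x \<otimes> inv y \<in> K}"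
      "b \<in> {y \<in> carrier G. x \<otimes> y \<otimes> inv x \<otimes> inv y \<in> K}"
    then have a: "a \<in> carrier G" "p x \<otimes>\<^bsub>Q\<^esub> p a = p a \<otimes>\<^bsub>Q\<^esub> p x"
      and b: "b \<in> carrier G" "p x \<otimes>\<^bsub>Q\<^esub> p b = p b \<otimes>\<^bsub>Q\<^esub> p x" using eq by auto
    then have "p x \<otimes>\<^bsub>Q\<^esub> p (a \<otimes> b) = p (a \<otimes> b) \<otimes>\<^bsub>Q\<^esub> p x"
      using x by (metis p.H.m_assoc p.hom_closed p.hom_mult)
    with a b show "a \<otimes> b \<in> {y \<in> carrier G. x \<otimes> y \<otimes> inv x \<otimes> inv y \<in> K}" using eq by simp
  qed auto
qed

lemma commutator_mem_sym:
  assumes "subgroup K G" "x \<in> carrier G" "y \<in> carrier G" "x \<otimes> y \<otimes> inv x \<otimes> inv y \<in> K"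
  shows "y \<otimes> x \<otimes> inv y \<otimes> inv x \<in> K"
proof -
  have "inv (x \<otimes> y \<otimes> inv x \<otimes> inv y) \<in> K"
    by (rule subgroup.m_inv_closed[OF assms(1,4)])
  then show ?thesis using assms by (simp add: inv_mult_group m_assoc)
qed

lemma central_modulo_normal:
  assumes K: "K \<lhd> G"
  shows "central_modulo G K \<lhd> G"
proof (rule subgroup_normal_if_central)
  have sub: "subgroup K G" using K normal_imp_subgroup by blast
  have "central_modulo G K = (\<Inter>x\<in>carrier G. {y \<in> carrier G. x \<otimes> y \<otimes> inv x \<otimes> inv y \<in> K})"
    unfolding central_modulo_def using commutator_mem_sym[OF sub] by auto
  also have "subgroup \<dots> G"
    using centralizer_modulo_subgroup[OF K] by (intro subgroups_Inter) auto
  finally show "subgroup (central_modulo G K) G" .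
qed (use normal_subset_central_modulo[OF K] in auto)

lemma upper_central_series_normal: "K \<lhd> G \<Longrightarrow> upper_central_series G K n \<lhd> G"
  by (induct n) (auto simp: central_modulo_normal)

lemma upper_central_series_mono:
  assumes "K \<lhd> G" "i \<le> j"
  shows "upper_central_series G K i \<subseteq> upper_central_series G K j"
  using assms(2)
proof (induct j rule: dec_induct)
  case (step j)
  then show ?case
    using normal_subset_central_modulo[OF upper_central_series_normal[OF assms(1), of j]] by simp
qed simp

text \<open>Comparison of the two series from the bottom up: commutators with the term of index
  \<open>n - Suc i\<close> of the lower series lie in the term of index \<open>n - i\<close>, hence
  by induction in the upper term \<open>i\<close>.\<close>

lemma upper_central_series_eq_carrier:
  assumes K: "K \<lhd> G" and n: "lower_central_series G n = {\<one>}"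
  shows "upper_central_series G K n = carrier G"
proof -
  \<comment> \<open>The first premise passes from each lower term to the one it generates, so it has
    to be checked only at \<open>i = n\<close>, where the term is \<open>carrier G\<close>
    itself.\<close>
  have "lower_central_series G (n - i) \<subseteq> carrier G \<Longrightarrow> i \<le> n \<Longrightarrow>
      lower_central_series G (n - i) \<subseteq> upper_central_series G K i" for i
  proof (induct i)
    case 0
    then show ?case
      using n K normal_imp_subgroup subgroup.one_closed by fastforce
  next
    case (Suc i)
    let ?L = "lower_central_series G (n - Suc i)"
    have "n - i = Suc (n - Suc i)" using Suc.prems by simp
    then have L: "lower_central_series G (n - i) = generate G (\<Union>x \<in> ?L. \<Union>g \<in> carrier G.
       {x \<otimes> g \<otimes> inv x \<otimes> inv g})" by simp
    have "lower_central_series G (n - i) \<subseteq> carrier G"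
      unfolding L using Suc.prems(1) by (intro generate_incl) auto
    then have IH: "lower_central_series G (n - i) \<subseteq> upper_central_series G K i"
      using Suc by simp
    show ?case
    proof
      fix x assume x: "x \<in> ?L"
      have "x \<otimes> g \<otimes> inv x \<otimes> inv g \<in> lower_central_series G (n - i)" if "g \<in> carrier G" for g
        unfolding L using x that by (auto intro: generate.incl)
      then show "x \<in> upper_central_series G K (Suc i)"
        using x Suc.prems IH by (auto simp: central_modulo_def)
    qed
  qed
  from this[of n] show ?thesis
    using upper_central_series_normal[OF K, of n] normal_imp_subgroup subgroup.subset by fastforce
qed

text \<open>The three facts are proved together: the next term is normal because it lies in the
  current one, whose commutators lie in the next term again; and its own commutators stay inside
  because it is normal.\<close>

lemma lower_central_series_normal:
  "lower_central_series G n \<lhd> G \<and> lower_central_series G (Suc n) \<subseteq> lower_central_series G n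
    \<and> lower_central_series G n \<subseteq> central_modulo G (lower_central_series G (Suc n))"
proof (induct n)
  have c: "L \<subseteq> carrier G \<Longrightarrow> L \<subseteq> central_modulo G (generate G (\<Union>x \<in> L. \<Union>g \<in> carrier G.
       {x \<otimes> g \<otimes> inv x \<otimes> inv g}))" for L
    by (auto simp: central_modulo_def intro!: generate.incl)
  {
    case 0
    show ?case using normal_self c[of "carrier G"]
      by (simp, intro generate_incl) auto
  next
    case (Suc n)
    let ?L = "lower_central_series G"
    have sub: "?L n \<subseteq> carrier G"
      using Suc normal_imp_subgroup subgroup.subset by blast
    then have sg: "subgroup (?L (Suc n)) G"
      unfolding lower_central_series.simps by (intro generate_is_subgroup) auto
    then have nor: "?L (Suc n) \<lhd> G"
      using Suc by (intro normal_if_commutators_mem) auto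
    moreover have "?L (Suc (Suc n)) \<subseteq> ?L (Suc n)"
    proof -
      have "x \<otimes> g \<otimes> inv x \<otimes> inv g \<in> ?L (Suc n)" if "x \<in> ?L (Suc n)" "g \<in> carrier G" for x g
        using normal_subset_central_modulo[OF nor] that by (auto simp: central_modulo_def)
      then show ?thesis
        unfolding lower_central_series.simps(2)[of G "Suc n"]
        by (intro generate_subgroup_incl sg) blast
    qed
    ultimately show ?case
      using c[of "?L (Suc n)"] sg subgroup.subset by simp blast
  }
qed

text \<open>Here \<open>y\<close> is the commutator of \<open>a\<close> and \<open>x\<close>, and
  the claim is \<open>[a^n, x] = [a, x]^n\<close> with inverses cleared.\<close>

lemma pow_commutator:
  assumes c: "a \<in> carrier G" "x \<in> carrier G" "y \<in> carrier G"
    and y: "a \<otimes> x = y \<otimes> x \<otimes> a" and comm: "a \<otimes> y = y \<otimes> a"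
  shows "a [^] (n::nat) \<otimes> x = y [^] n \<otimes> x \<otimes> a [^] n"
proof (induct n)
  case (Suc n)
  have cn: "a [^] n \<otimes> y = y \<otimes> a [^] n"
    using c comm by (metis pow_mult_distrib nat_pow_comm group_commutes_pow)
  have "a [^] Suc n \<otimes> x = a [^] n \<otimes> (a \<otimes> x)" using c by (simp add: m_assoc)
  also have "\<dots> = (a [^] n \<otimes> y) \<otimes> x \<otimes> a" using c y by (simp add: m_assoc)
  also have "\<dots> = y \<otimes> (a [^] n \<otimes> x) \<otimes> a" using c cn by (simp add: m_assoc)
  also have "\<dots> = (y \<otimes> y [^] n) \<otimes> x \<otimes> (a [^] n \<otimes> a)" using c Suc by (simp add: m_assoc)
  finally show ?case using c by (metis nat_pow_Suc nat_pow_Suc2)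
qed (use c in simp)

text \<open>Induction along the upper central series: if \<open>a\<close> commutes with \<open>y = [a, x]\<close> modulo \<open>K\<close>, then
  \<open>[a\<^sup>n, x]\<close> is \<open>y\<^sup>n\<close> modulo \<open>K\<close>.\<close>

lemma commutator_mem_if_pow_central:
  assumes K: "K \<lhd> G" and a: "a \<in> carrier G" and n: "n > (0::nat)"
    and an: "a [^] n \<in> central_modulo G K"
    and root: "\<And>y m. y \<in> upper_central_series G {\<one>} i \<Longrightarrow> m > (0::nat) \<Longrightarrow> y [^] m \<in> K \<Longrightarrow> y \<in> K"
    and x: "x \<in> upper_central_series G {\<one>} (Suc i)"
  shows "a \<otimes> x \<otimes> inv a \<otimes> inv x \<in> K"
proof -
  interpret K: normal K G by fact
  obtain Q :: "'a set monoid" and p where "group_hom G Q p"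
    and ker: "\<And>x. x \<in> carrier G \<Longrightarrow> p x = \<one>\<^bsub>Q\<^esub> \<longleftrightarrow> x \<in> K"
    using K.quotient_hom by metis
  then interpret p: group_hom G Q p by simp
  let ?Z = "upper_central_series G {\<one>}"
  have Z: "?Z l \<lhd> G" for l
    using one_is_normal upper_central_series_normal by blast
  \<comment> \<open>The commutator \<open>y\<close> of \<open>a\<close> and \<open>x\<close> lies
    one term lower, so \<open>x\<close> has to be arbitrary in the induction: the hypothesis is
    applied to \<open>y\<close>.\<close>
  have "x \<in> ?Z l \<Longrightarrow> l \<le> Suc i \<Longrightarrow> a \<otimes> x \<otimes> inv a \<otimes> inv x \<in> K" for l x
  proof (induct l arbitrary: x)
    case 0
    then show ?case using a K.one_closed by simp
  next
    case (Suc l)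
    define y where "y = a \<otimes> x \<otimes> inv a \<otimes> inv x"
    have x: "x \<in> carrier G" using Suc.prems by (auto simp: central_modulo_def)
    have "x \<otimes> a \<otimes> inv x \<otimes> inv a \<in> ?Z l" using Suc.prems a by (auto simp: central_modulo_def)
    then have yZ: "y \<in> ?Z l"
      unfolding y_def using commutator_mem_sym[of "?Z l" x a] x a Z normal_imp_subgroup by blast
    have yc: "y \<in> carrier G" using x a unfolding y_def by simp
    have "a \<otimes> y \<otimes> inv a \<otimes> inv y \<in> K" using Suc yZ by simp
    then have comm: "p a \<otimes>\<^bsub>Q\<^esub> p y = p y \<otimes>\<^bsub>Q\<^esub> p a"
      using ker[of "a \<otimes> y \<otimes> inv a \<otimes> inv y"] a yc p.H.commutator_eq_one_iff[of "p a" "p y"] by simp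
    have "a \<otimes> x = y \<otimes> x \<otimes> a" using a x unfolding y_def by (simp add: m_assoc)
    then have "p a \<otimes>\<^bsub>Q\<^esub> p x = p y \<otimes>\<^bsub>Q\<^esub> p x \<otimes>\<^bsub>Q\<^esub> p a" using a x yc by (metis m_closed p.hom_mult)
    then have 1: "p (a [^] n) \<otimes>\<^bsub>Q\<^esub> p x = p (y [^] n) \<otimes>\<^bsub>Q\<^esub> p x \<otimes>\<^bsub>Q\<^esub> p (a [^] n)"
      using p.H.pow_commutator[OF _ _ _ _ comm] a x yc by (simp add: p.hom_nat_pow)
    have "a [^] n \<otimes> x \<otimes> inv (a [^] n) \<otimes> inv x \<in> K"
      using an x by (simp add: central_modulo_def)
    then have "p (a [^] n) \<otimes>\<^bsub>Q\<^esub> p x = p x \<otimes>\<^bsub>Q\<^esub> p (a [^] n)"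
      using ker[of "a [^] n \<otimes> x \<otimes> inv (a [^] n) \<otimes> inv x"] a x
        p.H.commutator_eq_one_iff[of "p (a [^] n)" "p x"] by simp
    with 1 have "p (y [^] n) \<otimes>\<^bsub>Q\<^esub> (p x \<otimes>\<^bsub>Q\<^esub> p (a [^] n)) = p x \<otimes>\<^bsub>Q\<^esub> p (a [^] n)"
      using a x yc by (simp add: p.H.m_assoc)
    then have "p (y [^] n) = \<one>\<^bsub>Q\<^esub>"
      using a x yc by (subst (asm) p.H.r_cancel_one) auto
    then have "y [^] n \<in> K" using ker yc by simp
    \<comment> \<open>The bound \<open>l \<le> Suc i\<close> puts \<open>y\<close> into the term
      where \<open>root\<close> extracts roots.\<close>
    moreover have "y \<in> ?Z i"
      using yZ upper_central_series_mono[OF one_is_normal, of l i] Suc.prems by auto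
    ultimately show ?case using root[of y n] n unfolding y_def by blast
  qed
  then show ?thesis using x by blast
qed

end

section \<open>The torsion subgroup\<close>

context group
begin

lemma nat_pow_conj:
  assumes "x \<in> carrier G" "a \<in> carrier G"
  shows "(x \<otimes> a \<otimes> inv x) [^] (n::nat) = x \<otimes> a [^] n \<otimes> inv x"
proof (induct n)
  case (Suc n)
  have "x \<otimes> a [^] n \<otimes> inv x \<otimes> (x \<otimes> a \<otimes> inv x) = x \<otimes> (a [^] n \<otimes> a) \<otimes> inv x"
    using assms by (simp add: m_assoc inv_solve_left' flip: m_assoc[of "inv x" x])
  with Suc show ?case using assms by simp
qed (use assms in simp)

lemma torsion_subgroup_root:
  assumes "y \<in> carrier G" "m > (0::nat)" "y [^] m \<in> torsion_subgroup G"
  shows "y \<in> torsion_subgroup G"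
proof -
  obtain n :: nat where "n > 0" "(y [^] m) [^] n = \<one>"
    using assms unfolding torsion_subgroup_def by blast
  then have "m * n > 0" "y [^] (m * n) = \<one>" using assms nat_pow_pow by auto
  then show ?thesis using assms(1) unfolding torsion_subgroup_def by blast
qed

text \<open>Closure under products is the point. If \<open>a^n = b^m = 1\<close> in the next term,
  then \<open>a\<close> and \<open>b\<close> commute modulo \<open>?T i\<close>, because
  \<open>a^n\<close> is central and roots exist in \<open>?Z i\<close>. Thus
  \<open>(a b)^(n m)\<close> lies in \<open>?T i\<close>, and a root of a torsion element is
  torsion.\<close>

lemma torsion_upper_central_normal:
  "torsion_subgroup G \<inter> upper_central_series G {\<one>} i \<lhd> G"
proof (induct i)
  case 0
  have "torsion_subgroup G \<inter> {\<one>} = {\<one>}"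
    unfolding torsion_subgroup_def by (auto intro!: exI[of _ "1::nat"])
  then show ?case using one_is_normal by simp
next
  case (Suc i)
  let ?Z = "upper_central_series G {\<one>}"
  let ?T = "\<lambda>i. torsion_subgroup G \<inter> ?Z i"
  interpret T: normal "?T i" G by (rule Suc)
  interpret Z: normal "?Z (Suc i)" G by (rule upper_central_series_normal[OF one_is_normal])
  obtain Q :: "'a set monoid" and p where "group_hom G Q p"
    and ker: "\<And>x. x \<in> carrier G \<Longrightarrow> p x = \<one>\<^bsub>Q\<^esub> \<longleftrightarrow> x \<in> ?T i"
    using T.quotient_hom by metis
  then interpret p: group_hom G Q p by simp
  show ?case
  proof (rule normal_inv_iff[THEN iffD2], intro conjI ballI)
    show "subgroup (?T (Suc i)) G"
    proof (rule subgroupI)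
      show "?T (Suc i) \<subseteq> carrier G" unfolding torsion_subgroup_def by blast
    next
      have "\<one> [^] (1::nat) = \<one>" by simp
      then have "\<one> \<in> torsion_subgroup G" unfolding torsion_subgroup_def by blast
      then show "?T (Suc i) \<noteq> {}" using Z.one_closed by blast
    next
      fix a assume a: "a \<in> ?T (Suc i)"
      then obtain n :: nat where n: "n > 0" "a [^] n = \<one>" and ac: "a \<in> carrier G"
        unfolding torsion_subgroup_def by blast
      then have "inv a [^] n = \<one>" by (simp add: nat_pow_inv)
      then show "inv a \<in> ?T (Suc i)"
        using ac n(1) a Z.m_inv_closed unfolding torsion_subgroup_def by blast
    next
      fix a b assume a: "a \<in> ?T (Suc i)" and b: "b \<in> ?T (Suc i)"
      obtain n :: nat where n: "n > 0" "a [^] n = \<one>" and ac: "a \<in> carrier G"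
        using a unfolding torsion_subgroup_def by blast
      obtain m :: nat where m: "m > 0" "b [^] m = \<one>" and bc: "b \<in> carrier G"
        using b unfolding torsion_subgroup_def by blast
      have "a \<otimes> b \<otimes> inv a \<otimes> inv b \<in> ?T i"
      proof (rule commutator_mem_if_pow_central[OF Suc ac n(1), of i])
        show "a [^] n \<in> central_modulo G (?T i)"
          using n T.one_closed normal_subset_central_modulo[OF Suc] by auto
        show "b \<in> ?Z (Suc i)" using b by blast
        fix y m assume "y \<in> ?Z i" "(0::nat) < m" "y [^] m \<in> ?T i"
        moreover have "?Z i \<subseteq> carrier G"
          by (rule subgroup.subset[OF normal_imp_subgroup[OF upper_central_series_normal[OF one_is_normal]]])
        ultimately show "y \<in> ?T i" using torsion_subgroup_root[of y m] by auto
      qed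
      then have "p a \<otimes>\<^bsub>Q\<^esub> p b = p b \<otimes>\<^bsub>Q\<^esub> p a"
        using ker[of "a \<otimes> b \<otimes> inv a \<otimes> inv b"] ac bc p.H.commutator_eq_one_iff[of "p a" "p b"] by simp
      then have "p ((a \<otimes> b) [^] (n * m)) = p (a [^] (n * m)) \<otimes>\<^bsub>Q\<^esub> p (b [^] (n * m))"
        using ac bc p.H.pow_mult_distrib[of "p a" "p b"] by (simp add: p.hom_nat_pow)
      also have "a [^] (n * m) = \<one>" using n ac by (simp flip: nat_pow_pow)
      also have "b [^] (n * m) = \<one>" using m bc by (simp add: mult.commute[of n] flip: nat_pow_pow)
      finally have "(a \<otimes> b) [^] (n * m) \<in> ?T i" using ker ac bc by simp
      then have "a \<otimes> b \<in> torsion_subgroup G"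
        using torsion_subgroup_root[of "a \<otimes> b" "n * m"] n m ac bc by simp
      then show "a \<otimes> b \<in> ?T (Suc i)" using a b Z.m_closed by blast
    qed
  next
    fix x a assume x: "x \<in> carrier G" and a: "a \<in> ?T (Suc i)"
    then obtain n :: nat where n: "n > 0" "a [^] n = \<one>" and ac: "a \<in> carrier G"
      unfolding torsion_subgroup_def by blast
    then have "(x \<otimes> a \<otimes> inv x) [^] n = \<one>" using x by (simp add: nat_pow_conj)
    moreover have "x \<otimes> a \<otimes> inv x \<in> carrier G" using x ac by simp
    ultimately have "x \<otimes> a \<otimes> inv x \<in> torsion_subgroup G"
      using n(1) unfolding torsion_subgroup_def by blast
    then show "x \<otimes> a \<otimes> inv x \<in> ?T (Suc i)"
      using a x Z.inv_op_closed2 by blast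
  qed
qed

end

section \<open>Finiteness of the torsion subgroup\<close>

text \<open>Subgroups reached from the trivial one by finitely many central cyclic extensions;
  induction along such a chain bounds the torsion.\<close>

inductive cyclic_central_chain :: "('a, 'b) monoid_scheme \<Rightarrow> 'a set \<Rightarrow> bool" for G where
  trivial: "cyclic_central_chain G {\<one>\<^bsub>G\<^esub>}"
| extend: "cyclic_central_chain G H \<Longrightarrow> g \<in> central_modulo G H \<Longrightarrow>
    cyclic_central_chain G (H <#>\<^bsub>G\<^esub> generate G {g})"

context group
begin

text \<open>The product lies between \<open>H\<close> and the elements central modulo
  \<open>H\<close>, and every subgroup in that range is normal.\<close>

lemma normal_mult_generate:
  assumes H: "H \<lhd> G" and g: "g \<in> central_modulo G H"
  shows "H <#> generate G {g} \<lhd> G" "H \<subseteq> H <#> generate G {g}" "g \<in> H <#> generate G {g}"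
proof -
  have gc: "g \<in> carrier G" using g by (simp add: central_modulo_def)
  interpret H: normal H G by fact
  interpret C: normal "central_modulo G H" G by (rule central_modulo_normal[OF H])
  have gs: "subgroup (generate G {g}) G" by (rule generate_is_subgroup) (use gc in auto)
  have sub: "subgroup (H <#> generate G {g}) G" by (rule mult_norm_subgroup[OF H gs])
  show inc: "H \<subseteq> H <#> generate G {g}"
  proof
    fix h assume "h \<in> H"
    moreover have "h = h \<otimes> \<one>" using calculation by simp
    ultimately show "h \<in> H <#> generate G {g}"
      unfolding set_mult_def using generate.one by blast
  qed
  have "g = \<one> \<otimes> g" using gc by simp
  then show "g \<in> H <#> generate G {g}"
    unfolding set_mult_def using H.one_closed generate.incl[of g "{g}"] by blast
  have "generate G {g} \<subseteq> central_modulo G H"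
    by (rule generate_subgroup_incl) (use g C.subgroup_axioms in auto)
  then have "H <#> generate G {g} \<subseteq> central_modulo G H"
    using normal_subset_central_modulo[OF H] C.m_closed unfolding set_mult_def by blast
  then show "H <#> generate G {g} \<lhd> G"
    by (rule subgroup_normal_if_central[OF sub inc])
qed

lemma cyclic_central_chain_normal: "cyclic_central_chain G H \<Longrightarrow> H \<lhd> G"
  by (induct rule: cyclic_central_chain.induct) (auto intro: one_is_normal normal_mult_generate(1))

text \<open>The intersection is empty or a single coset of \<open>N \<inter> H\<close>.\<close>

lemma finite_Int_coset:
  assumes N: "subgroup N G" and H: "subgroup H G" and fin: "finite (N \<inter> H)" and y: "y \<in> carrier G"
  shows "finite (N \<inter> (H #> y))"
proof (cases "N \<inter> (H #> y) = {}")
  case False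
  then obtain h where h: "h \<in> H" "h \<otimes> y \<in> N" unfolding r_coset_def by blast
  have "N \<inter> (H #> y) \<subseteq> (\<lambda>u. u \<otimes> (h \<otimes> y)) ` (N \<inter> H)"
  proof
    fix u assume u: "u \<in> N \<inter> (H #> y)"
    then obtain k where k: "k \<in> H" "u = k \<otimes> y" unfolding r_coset_def by blast
    have c: "h \<in> carrier G" "k \<in> carrier G" "u \<in> carrier G"
      using h k y subgroup.mem_carrier[OF H] by auto
    have 1: "u \<otimes> inv (h \<otimes> y) = k \<otimes> inv h"
      using k c y by (simp add: inv_mult_group m_assoc) (simp flip: m_assoc)
    have "u \<otimes> inv (h \<otimes> y) \<in> N"
      using u h subgroup.m_closed[OF N] subgroup.m_inv_closed[OF N] by auto
    moreover have "u \<otimes> inv (h \<otimes> y) \<in> H"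
      unfolding 1 using h k subgroup.m_closed[OF H] subgroup.m_inv_closed[OF H] by auto
    moreover have "u = (u \<otimes> inv (h \<otimes> y)) \<otimes> (h \<otimes> y)"
      using c y by (simp add: m_assoc)
    ultimately show "u \<in> (\<lambda>u. u \<otimes> (h \<otimes> y)) ` (N \<inter> H)" by blast
  qed
  then show ?thesis using fin finite_surj by blast
qed simp

text \<open>In an extension by \<open>g\<close>, either a positive power of \<open>g\<close> lies in
  \<open>H\<close>, and finitely many cosets of \<open>H\<close> suffice, or \<open>g\<close> has
  infinite order modulo \<open>H\<close>, and a torsion element \<open>h g^z\<close> must have
  \<open>z = 0\<close>, so no torsion is added.\<close>

lemma finite_torsion_Int_chain:
  assumes N: "torsion_subgroup G \<lhd> G" and "cyclic_central_chain G H"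
  shows "finite (torsion_subgroup G \<inter> H)"
  using assms(2)
proof induct
  case (extend H g)
  let ?N = "torsion_subgroup G"
  interpret N: normal ?N G by fact
  interpret H: normal H G using extend(1) by (rule cyclic_central_chain_normal)
  have g: "g \<in> carrier G" using extend by (simp add: central_modulo_def)
  have E: "\<exists>h\<in>H. \<exists>z::int. e = h \<otimes> g [^] z" if "e \<in> H <#> generate G {g}" for e
    using that generate_pow[OF g] unfolding set_mult_def by auto
  show ?case
  proof (cases "\<exists>k>0. g [^] (k::nat) \<in> H")
    case True
    then obtain k :: nat where k: "k > 0" "g [^] k \<in> H" by blast
    have "?N \<inter> (H <#> generate G {g}) \<subseteq> (\<Union>j<k. ?N \<inter> (H #> g [^] j))"
    proof
      fix e assume e: "e \<in> ?N \<inter> (H <#> generate G {g})"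
      then obtain h z where h: "h \<in> H" "e = h \<otimes> g [^] (z::int)" using E by blast
      define j where "j = nat (z mod int k)"
      have j: "j < k" "int j = z mod int k" using k unfolding j_def by (auto simp: nat_less_iff)
      have "g [^] z = g [^] (int k * (z div int k) + int j)" using j by simp
      also have "\<dots> = (g [^] k) [^] (z div int k) \<otimes> g [^] j"
        using g by (simp add: int_pow_mult int_pow_pow flip: int_pow_int)
      finally have "e = (h \<otimes> (g [^] k) [^] (z div int k)) \<otimes> g [^] j"
        using h g by (simp add: m_assoc)
      moreover have "h \<otimes> (g [^] k) [^] (z div int k) \<in> H"
        using h k subgroup_int_pow_closed[OF H.subgroup_axioms] by simp
      ultimately have "e \<in> H #> g [^] j" unfolding r_coset_def by blast
      then show "e \<in> (\<Union>j<k. ?N \<inter> (H #> g [^] j))" using e j by blast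
    qed
    moreover have "finite (\<Union>j<k. ?N \<inter> (H #> g [^] j))"
      using finite_Int_coset[OF N.subgroup_axioms H.subgroup_axioms extend(2)] g
      by (intro finite_UN_I) auto
    ultimately show ?thesis by (rule finite_subset)
  next
    case False
    obtain Q :: "'a set monoid" and p where "group_hom G Q p"
      and ker: "\<And>x. x \<in> carrier G \<Longrightarrow> p x = \<one>\<^bsub>Q\<^esub> \<longleftrightarrow> x \<in> H"
      using H.quotient_hom by metis
    then interpret p: group_hom G Q p by simp
    have "?N \<inter> (H <#> generate G {g}) \<subseteq> ?N \<inter> H"
    proof
      fix e assume e: "e \<in> ?N \<inter> (H <#> generate G {g})"
      then obtain h z where h: "h \<in> H" "e = h \<otimes> g [^] (z::int)" using E by blast
      obtain n :: nat where n: "n > 0" "e [^] n = \<one>" and ec: "e \<in> carrier G"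
        using e unfolding torsion_subgroup_def by blast
      have "p e = p (g [^] z)" using h g ker[of h] by simp
      then have "p (e [^] n) = p ((g [^] z) [^] n)" using ec g by (simp add: p.hom_nat_pow)
      then have "p ((g [^] z) [^] n) = \<one>\<^bsub>Q\<^esub>" using n by simp
      then have "(g [^] z) [^] n \<in> H" using g ker[of "(g [^] z) [^] n"] by simp
      then have zn: "g [^] (z * int n) \<in> H" using g by (simp add: int_pow_pow flip: int_pow_int)
      have "z = 0"
      proof (rule ccontr)
        assume "z \<noteq> 0"
        \<comment> \<open>The exponent \<open>z * int n\<close> may be negative, whereas the case
          assumption concerns natural exponents.\<close>
        have "g [^] nat \<bar>z * int n\<bar> \<in> H"
        proof (cases "z * int n \<ge> 0")
          case True
          then show ?thesis using zn by (simp flip: int_pow_int)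
        next
          case False
          then have "g [^] nat \<bar>z * int n\<bar> = inv (g [^] (z * int n))"
            using g by (simp add: int_pow_neg flip: int_pow_int)
          then show ?thesis using zn by simp
        qed
        moreover have "nat \<bar>z * int n\<bar> > 0" using \<open>z \<noteq> 0\<close> n by simp
        ultimately show False using False by blast
      qed
      then show "e \<in> ?N \<inter> H" using e h by simp
    qed
    then show ?thesis using extend(2) finite_subset by blast
  qed
qed simp

text \<open>Elements central modulo \<open>H\<close> stay central modulo anything larger, so those
  of \<open>X\<close> can be adjoined one after another.\<close>

lemma cyclic_central_chain_extend_finite:
  assumes "finite X" and "cyclic_central_chain G H" and "X \<subseteq> central_modulo G H"
  shows "\<exists>H'. cyclic_central_chain G H' \<and> H \<subseteq> H' \<and> X \<subseteq> H'"
  using assms(1,3)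
proof induct
  case (insert x X)
  then obtain H' where H': "cyclic_central_chain G H'" "H \<subseteq> H'" "X \<subseteq> H'" by auto
  then have x: "x \<in> central_modulo G H'" using insert central_modulo_mono by blast
  note n = normal_mult_generate[OF cyclic_central_chain_normal[OF H'(1)] x]
  show ?case
    using cyclic_central_chain.extend[OF H'(1) x] n(2,3) H'(2,3)
    by (intro exI[of _ "H' <#> generate G {x}"]) auto
qed (use assms(2) in auto)

text \<open>If \<open>X\<close> generates a term modulo the next one, then the commutators of
  \<open>X\<close> with \<open>S\<close> generate the next term modulo the one after it. Finite
  generation thus passes down the series.\<close>

lemma lower_central_series_finitely_generated_step:
  assumes S: "finite S" "S \<subseteq> carrier G" "generate G S = carrier G"
  shows "\<exists>X. finite X \<and> X \<subseteq> lower_central_series G i \<and>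
    lower_central_series G i \<subseteq> generate G (X \<union> lower_central_series G (Suc i))"
proof (induct i)
  case 0
  have "generate G S \<subseteq> generate G (S \<union> lower_central_series G (Suc 0))"
    by (intro mono_generate) auto
  then show ?case using S by (auto simp del: lower_central_series.simps(2))
next
  case (Suc i)
  let ?L = "lower_central_series G"
  have Lsub: "?L j \<subseteq> carrier G" for j
    using lower_central_series_normal normal_imp_subgroup subgroup.subset by blast
  obtain X where X: "finite X" "X \<subseteq> ?L i" "?L i \<subseteq> generate G (X \<union> ?L (Suc i))"
    using Suc by blast
  define Y where "Y = (\<lambda>(x, s). x \<otimes> s \<otimes> inv x \<otimes> inv s) ` (X \<times> S)"
  \<comment> \<open>\<open>M\<close> will turn out to contain \<open>?L (Suc i)\<close>. It is
    normal, and elements of \<open>X\<close> commute with all of \<open>S\<close> modulo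
    \<open>M\<close>; hence all of \<open>?L i\<close> is central modulo \<open>M\<close>.\<close>
  define M where "M = generate G (Y \<union> ?L (Suc (Suc i)))"
  have Y: "Y \<subseteq> ?L (Suc i)"
  proof -
    have "x \<otimes> s \<otimes> inv x \<otimes> inv s \<in> ?L (Suc i)" if "x \<in> X" "s \<in> S" for x s
      using lower_central_series_normal[of i] that X S unfolding central_modulo_def by blast
    then show ?thesis unfolding Y_def by auto
  qed
  have Yc: "Y \<union> ?L (Suc (Suc i)) \<subseteq> central_modulo G (?L (Suc (Suc i)))"
    using Y lower_central_series_normal[of "Suc i"]
      normal_subset_central_modulo[of "?L (Suc (Suc i))"] lower_central_series_normal[of "Suc (Suc i)"]
    by blast
  have Msub: "subgroup M G"
    unfolding M_def using Y Lsub by (intro generate_is_subgroup) blast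
  have Minc: "Y \<union> ?L (Suc (Suc i)) \<subseteq> M"
    unfolding M_def by (auto intro: generate.incl)
  have "M \<subseteq> central_modulo G (?L (Suc (Suc i)))"
    unfolding M_def
    by (rule generate_subgroup_incl[OF Yc])
      (use central_modulo_normal lower_central_series_normal normal_imp_subgroup in blast)
  then have M: "M \<lhd> G"
    using subgroup_normal_if_central[OF Msub _, of "?L (Suc (Suc i))"] Minc by blast
  have "X \<subseteq> central_modulo G M"
  proof
    fix x assume x: "x \<in> X"
    then have xc: "x \<in> carrier G" using X Lsub by blast
    have "S \<subseteq> {y \<in> carrier G. x \<otimes> y \<otimes> inv x \<otimes> inv y \<in> M}"
      using x S Minc unfolding Y_def by auto
    then have "carrier G \<subseteq> {y \<in> carrier G. x \<otimes> y \<otimes> inv x \<otimes> inv y \<in> M}"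
      using generate_subgroup_incl[OF _ centralizer_modulo_subgroup[OF M xc]] S by blast
    then show "x \<in> central_modulo G M" using xc unfolding central_modulo_def by blast
  qed
  moreover have "?L (Suc i) \<subseteq> central_modulo G M"
    using lower_central_series_normal[of "Suc i"] central_modulo_mono[of "?L (Suc (Suc i))" M] Minc by blast
  ultimately have "?L i \<subseteq> central_modulo G M"
    using X(3) generate_subgroup_incl[of "X \<union> ?L (Suc i)" "central_modulo G M"]
      normal_imp_subgroup[OF central_modulo_normal[OF M]] by blast
  then have "(\<Union>x \<in> ?L i. \<Union>g \<in> carrier G. {x \<otimes> g \<otimes> inv x \<otimes> inv g}) \<subseteq> M"
    unfolding central_modulo_def by blast
  then have "?L (Suc i) \<subseteq> M"
    unfolding lower_central_series.simps(2)[of G i] by (rule generate_subgroup_incl[OF _ Msub])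
  moreover have "finite Y" unfolding Y_def using X S by simp
  ultimately show ?case using Y unfolding M_def by blast
qed

text \<open>The lower central series is climbed from its trivial term; at each stage the finitely
  many generators of the next term are central modulo the subgroup reached so far.\<close>

lemma cyclic_central_chain_carrier:
  assumes S: "finite S" "S \<subseteq> carrier G" "generate G S = carrier G"
    and n: "lower_central_series G n = {\<one>}"
  shows "cyclic_central_chain G (carrier G)"
proof -
  let ?L = "lower_central_series G"
  have "i \<le> n \<Longrightarrow> \<exists>H. cyclic_central_chain G H \<and> ?L (n - i) \<subseteq> H" for i
  proof (induct i)
    case 0
    then show ?case using n cyclic_central_chain.trivial by auto
  next
    case (Suc i)
    then obtain H where H: "cyclic_central_chain G H" "?L (n - i) \<subseteq> H" by auto
    define j where "j = n - Suc i"
    have j: "n - i = Suc j" using Suc.prems unfolding j_def by simp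
    obtain X where X: "finite X" "X \<subseteq> ?L j" "?L j \<subseteq> generate G (X \<union> ?L (Suc j))"
      using lower_central_series_finitely_generated_step[OF S] by blast
    have "?L j \<subseteq> central_modulo G H"
      using lower_central_series_normal[of j] central_modulo_mono[of "?L (Suc j)" H] H(2)[unfolded j] by blast
    then have "X \<subseteq> central_modulo G H" using X(2) by blast
    then obtain H' where H': "cyclic_central_chain G H'" "H \<subseteq> H'" "X \<subseteq> H'"
      using cyclic_central_chain_extend_finite[OF X(1) H(1)] by blast
    then have "X \<union> ?L (Suc j) \<subseteq> H'" using H(2)[unfolded j] by blast
    then have "?L j \<subseteq> H'"
      using X(3) generate_subgroup_incl[OF _ normal_imp_subgroup[OF cyclic_central_chain_normal[OF H'(1)]]]
      by blast
    then show ?case using H'(1) unfolding j_def by blast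
  qed
  from this[of n] obtain H where H: "cyclic_central_chain G H" "carrier G \<subseteq> H" by auto
  moreover have "H \<subseteq> carrier G"
    by (rule subgroup.subset[OF normal_imp_subgroup[OF cyclic_central_chain_normal[OF H(1)]]])
  ultimately show ?thesis by (metis subset_antisym)
qed

end

section \<open>Finitely generated nilpotent groups and the central series above the torsion\<close>

locale fg_nilpotent_group = group G for G :: "('a, 'b) monoid_scheme" (structure) +
  fixes S :: "'a set"
  assumes nilpotent: "\<exists>n. lower_central_series G n = {\<one>}"
    and generators: "symmetric_finite_generating_set G S"
begin

lemma finite_S: "finite S" and S_subset: "S \<subseteq> carrier G" and S_inv: "set_inv S = S"
  and generate_S: "generate G S = carrier G"
  using generators unfolding symmetric_finite_generating_set_def by auto

lemma inv_mem_S: "s \<in> S \<Longrightarrow> inv s \<in> S"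
  using S_inv unfolding SET_INV_def by blast

lemma S_closed [simp]: "s \<in> S \<Longrightarrow> s \<in> carrier G"
  using S_subset by blast

lemma induct_right:
  assumes "g \<in> carrier G" "P \<one>"
    and "\<And>h s. h \<in> carrier G \<Longrightarrow> s \<in> S \<Longrightarrow> P h \<Longrightarrow> P (h \<otimes> s)"
  shows "P g"
  using generate_induct_right[OF S_subset S_inv, of g P] assms generate_S by blast

abbreviation tors :: "'a set" where "tors \<equiv> torsion_subgroup G"

abbreviation ser :: "nat \<Rightarrow> 'a set" where "ser \<equiv> upper_central_series G tors"

lemma torsion_normal: "tors \<lhd> G"
proof -
  obtain n where "lower_central_series G n = {\<one>}" using nilpotent by blast
  then have "upper_central_series G {\<one>} n = carrier G"
    using upper_central_series_eq_carrier one_is_normal by blast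
  moreover have "tors \<subseteq> carrier G" unfolding torsion_subgroup_def by blast
  ultimately show ?thesis using torsion_upper_central_normal[of n] by (simp add: inf_absorb1)
qed

lemma torsion_finite: "finite tors"
proof -
  obtain n where "lower_central_series G n = {\<one>}" using nilpotent by blast
  then have "finite (tors \<inter> carrier G)"
    using finite_torsion_Int_chain[OF torsion_normal] cyclic_central_chain_carrier
      finite_S S_subset generate_S by blast
  moreover have "tors \<subseteq> carrier G" unfolding torsion_subgroup_def by blast
  ultimately show ?thesis by (simp add: inf_absorb1)
qed

lemma ser_normal: "ser i \<lhd> G"
  by (rule upper_central_series_normal[OF torsion_normal])

lemma ser_eq_carrier: "\<exists>n. ser n = carrier G"
  using nilpotent upper_central_series_eq_carrier[OF torsion_normal] by blast

lemma ser_closed: "x \<in> ser i \<Longrightarrow> x \<in> carrier G"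
  by (rule subgroup.mem_carrier[OF normal_imp_subgroup[OF ser_normal]])

lemma ser_subset_Suc: "ser i \<subseteq> ser (Suc i)"
  using upper_central_series_mono[OF torsion_normal, of i "Suc i"] by simp

text \<open>Torsion-freeness of the quotients, as closure under roots. A root of an element central
  modulo \<open>ser i\<close> is itself central there by
  \<open>commutator_mem_if_pow_central\<close>, which uses closure under roots one level
  lower.\<close>

lemma ser_root:
  assumes "y \<in> carrier G" "m > (0::nat)" "y [^] m \<in> ser i"
  shows "y \<in> ser i"
  using assms
proof (induct i arbitrary: y m)
  case 0
  then show ?case using torsion_subgroup_root by simp
next
  case (Suc i)
  obtain n where n: "lower_central_series G n = {\<one>}" using nilpotent by blast
  then have Z: "upper_central_series G {\<one>} n = carrier G"
    using upper_central_series_eq_carrier one_is_normal by blast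
  \<comment> \<open>The extra index is there because \<open>commutator_mem_if_pow_central\<close>
    takes \<open>x\<close> from a successor term.\<close>
  then have Z': "upper_central_series G {\<one>} (Suc n) = carrier G"
    using upper_central_series_mono[OF one_is_normal, of n "Suc n"]
    by (auto simp: central_modulo_def)
  have "y \<otimes> x \<otimes> inv y \<otimes> inv x \<in> ser i" if "x \<in> carrier G" for x
  proof (rule commutator_mem_if_pow_central[OF ser_normal Suc.prems(1,2)])
    show "y [^] m \<in> central_modulo G (ser i)" using Suc.prems(3) by simp
    show "x \<in> upper_central_series G {\<one>} (Suc n)" unfolding Z' by (rule that)
    show "\<And>y m. y \<in> upper_central_series G {\<one>} n \<Longrightarrow> 0 < m \<Longrightarrow> y [^] (m::nat) \<in> ser i \<Longrightarrow> y \<in> ser i"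
      unfolding Z by (rule Suc.hyps)
  qed
  then show ?case using Suc.prems(1) by (simp add: central_modulo_def)
qed

end

section \<open>A maximum principle\<close>

context comm_group
begin

text \<open>Extreme points of finite sets exist because a non-extreme point can be eliminated from any
  convex combination of the remaining ones.\<close>

lemma exists_extreme_point:
  assumes F: "finite F" "F \<noteq> {}" "F \<subseteq> carrier G"
    and tf: "\<And>x n. x \<in> carrier G \<Longrightarrow> n > (0::nat) \<Longrightarrow> x [^] n = \<one> \<Longrightarrow> x = \<one>"
  shows "\<exists>v\<in>F. \<forall>m :: 'a \<Rightarrow> nat. (\<Otimes>w\<in>F. w [^] m w) = v [^] (\<Sum>w\<in>F. m w) \<longrightarrow>
    (\<forall>w\<in>F. w \<noteq> v \<longrightarrow> m w = 0)"
  using F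
proof (induct rule: finite_ne_induct)
  case (insert u F)
  then obtain v where v: "v \<in> F" and ext: "\<And>m :: 'a \<Rightarrow> nat.
      (\<Otimes>w\<in>F. w [^] m w) = v [^] (\<Sum>w\<in>F. m w) \<Longrightarrow> (\<forall>w\<in>F. w \<noteq> v \<longrightarrow> m w = 0)"
    by (metis insert_subset)
  have F: "F \<subseteq> carrier G" and u: "u \<in> carrier G" and vc: "v \<in> carrier G"
    using insert.prems v by auto
  have ins: "(\<Otimes>w\<in>insert u F. w [^] m w) = u [^] m u \<otimes> (\<Otimes>w\<in>F. w [^] m w)" for m :: "'a \<Rightarrow> nat"
    using insert.hyps F u by (subst finprod_insert) auto
  have P: "(\<Otimes>w\<in>F. w [^] m w) \<in> carrier G" for m :: "'a \<Rightarrow> nat"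
    using F by (intro finprod_closed) auto
  show ?case
  proof (cases "\<forall>m :: 'a \<Rightarrow> nat. (\<Otimes>w\<in>insert u F. w [^] m w) = v [^] (\<Sum>w\<in>insert u F. m w) \<longrightarrow>
    (\<forall>w\<in>insert u F. w \<noteq> v \<longrightarrow> m w = 0)")
    case True
    then show ?thesis using v by blast
  next
    case False
    then obtain m :: "'a \<Rightarrow> nat" and w0 where
      m: "(\<Otimes>w\<in>insert u F. w [^] m w) = v [^] (\<Sum>w\<in>insert u F. m w)"
      and w0: "w0 \<in> insert u F" "w0 \<noteq> v" "m w0 \<noteq> 0" by blast
    let ?M = "\<Sum>w\<in>F. m w"
    have m': "u [^] m u \<otimes> (\<Otimes>w\<in>F. w [^] m w) = v [^] (m u + ?M)"
      using m insert.hyps unfolding ins by simp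
    \<comment> \<open>Otherwise \<open>m\<close> would already contradict extremality of
      \<open>v\<close> in \<open>F\<close>.\<close>
    have mu: "m u > 0"
    proof (rule ccontr)
      assume "\<not> m u > 0"
      then have "(\<Otimes>w\<in>F. w [^] m w) = v [^] ?M" using m' P by simp
      then have "\<forall>w\<in>F. w \<noteq> v \<longrightarrow> m w = 0" by (rule ext)
      then show False using w0 \<open>\<not> m u > 0\<close> by auto
    qed
    show ?thesis
    proof (intro bexI[of _ u] allI impI ballI)
      fix l :: "'a \<Rightarrow> nat" and w1
      assume l: "(\<Otimes>w\<in>insert u F. w [^] l w) = u [^] (\<Sum>w\<in>insert u F. l w)"
        and w1: "w1 \<in> insert u F" "w1 \<noteq> u"
      let ?L = "\<Sum>w\<in>F. l w"
      have "u [^] l u \<otimes> (\<Otimes>w\<in>F. w [^] l w) = u [^] l u \<otimes> u [^] ?L"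
        using l insert.hyps u unfolding ins by (simp add: nat_pow_mult)
      then have l': "(\<Otimes>w\<in>F. w [^] l w) = u [^] ?L" using u P by simp
      \<comment> \<open>Scaling the relation for \<open>l\<close> by \<open>m u\<close> and the one
        for \<open>m\<close> by \<open>?L\<close> eliminates \<open>u\<close>: what remains is a
        combination over \<open>F\<close> equal to a power of \<open>v\<close>, to which extremality
        of \<open>v\<close> applies.\<close>
      have "(\<Otimes>w\<in>F. w [^] (m u * l w + ?L * m w))
          = (\<Otimes>w\<in>F. (w [^] l w) [^] m u) \<otimes> (\<Otimes>w\<in>F. (w [^] m w) [^] ?L)"
        using F by (subst finprod_multf[symmetric])
          (auto intro!: finprod_cong' simp: nat_pow_pow nat_pow_mult mult.commute)
      also have "\<dots> = (\<Otimes>w\<in>F. w [^] l w) [^] m u \<otimes> (\<Otimes>w\<in>F. w [^] m w) [^] ?L"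
      proof -
        have pw: "(\<Otimes>w\<in>F. f w [^] k) = (\<Otimes>w\<in>F. f w) [^] k" if "f \<in> F \<rightarrow> carrier G" for f and k :: nat
          using insert.hyps(1) that
        proof (induct F rule: finite_induct)
          case (insert x A)
          then have "f \<in> A \<rightarrow> carrier G" "f x \<in> carrier G" by auto
          moreover have "(\<lambda>w. f w [^] k) \<in> A \<rightarrow> carrier G" using calculation by auto
          ultimately show ?case using insert by (simp add: nat_pow_distrib)
        qed simp
        show ?thesis using F by (subst (1 2) pw) auto
      qed
      also have "\<dots> = (u [^] m u) [^] ?L \<otimes> (\<Otimes>w\<in>F. w [^] m w) [^] ?L"
        using u by (simp add: l' nat_pow_pow mult.commute)
      also have "\<dots> = (v [^] (m u + ?M)) [^] ?L"
        using u P by (simp add: nat_pow_distrib[symmetric] m')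
      also have "\<dots> = v [^] (\<Sum>w\<in>F. m u * l w + ?L * m w)"
      proof -
        have "(\<Sum>w\<in>F. m u * l w + ?L * m w) = (m u + ?M) * ?L"
          unfolding sum.distrib sum_distrib_left[symmetric] by (simp add: algebra_simps)
        then show ?thesis using vc by (simp add: nat_pow_pow)
      qed
      finally have z: "\<forall>w\<in>F. w \<noteq> v \<longrightarrow> m u * l w + ?L * m w = 0" by (rule ext)
      then have lz: "\<forall>w\<in>F. w \<noteq> v \<longrightarrow> l w = 0" using mu by auto
      have "(\<Otimes>w\<in>F. w [^] l w) = (\<Otimes>w\<in>F. if v = w then v [^] l v else \<one>)"
        using lz F by (intro finprod_cong') auto
      also have "\<dots> = v [^] l v"
        using insert.hyps(1) v vc finprod_singleton[of v F "\<lambda>w. v [^] l v"] by auto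
      finally have uv: "u [^] ?L = v [^] l v" using l' by simp
      have "?L = (\<Sum>w\<in>F. if w = v then l v else 0)"
        using lz by (intro sum.cong) auto
      then have L: "?L = l v" using insert.hyps(1) v by simp
      \<comment> \<open>All weight of \<open>l\<close> on \<open>F\<close> now sits at
        \<open>v\<close>, so \<open>u\<close> and \<open>v\<close> have equal powers with exponent
        \<open>l v\<close>; torsion-freeness and \<open>u \<noteq> v\<close> force
        \<open>l v = 0\<close>.\<close>
      have "(u \<otimes> inv v) [^] l v = \<one>"
        using uv u vc unfolding L by (simp add: nat_pow_distrib nat_pow_inv)
      moreover have "u \<otimes> inv v \<noteq> \<one>"
        using u vc insert.hyps(3) v by (metis inv_equality inv_inv inv_closed)
      ultimately have "l v = 0" using tf[of "u \<otimes> inv v" "l v"] u vc by auto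
      then show "l w1 = 0" using lz w1 by auto
    qed simp
  qed
qed simp

text \<open>Grouping the indices by value turns an indexed product into one over \<open>F\<close>
  whose exponents are multiplicities. One \<open>v\<close> serves all families.\<close>

lemma exists_extreme_value:
  assumes F: "finite F" "F \<noteq> {}" "F \<subseteq> carrier G"
    and tf: "\<And>x n. x \<in> carrier G \<Longrightarrow> n > (0::nat) \<Longrightarrow> x [^] n = \<one> \<Longrightarrow> x = \<one>"
  shows "\<exists>v\<in>F. \<forall>I (f :: 'i \<Rightarrow> 'a). finite I \<longrightarrow> f \<in> I \<rightarrow> F \<longrightarrow> (\<Otimes>i\<in>I. f i) = v [^] card I \<longrightarrow>
    (\<forall>i\<in>I. f i = v)"
proof -
  obtain v where v: "v \<in> F" and ext: "\<And>m :: 'a \<Rightarrow> nat.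
      (\<Otimes>w\<in>F. w [^] m w) = v [^] (\<Sum>w\<in>F. m w) \<Longrightarrow> (\<forall>w\<in>F. w \<noteq> v \<longrightarrow> m w = 0)"
    using exists_extreme_point[OF F] tf by blast
  have "\<forall>i\<in>I. f i = v" if I: "finite I" and f: "f \<in> I \<rightarrow> F" and eq: "(\<Otimes>i\<in>I. f i) = v [^] card I"
    for I and f :: "'i \<Rightarrow> 'a"
  proof -
    have "(\<Otimes>i\<in>I. f i) = (\<Otimes>w\<in>F. w [^] card {i\<in>I. f i = w}) \<and> card I = (\<Sum>w\<in>F. card {i\<in>I. f i = w})"
      using I f
    proof (induct I rule: finite_induct)
      case empty
      then show ?case using F by (simp add: finprod_one_eqI)
    next
      case (insert j I)
      then have fj: "f j \<in> F" and fI: "f \<in> I \<rightarrow> F" by auto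
      have card: "card {i \<in> insert j I. f i = w} = card {i\<in>I. f i = w} + (if f j = w then 1 else 0)" for w
      proof (cases "f j = w")
        case True
        then have "{i \<in> insert j I. f i = w} = insert j {i\<in>I. f i = w}" by auto
        then show ?thesis using True insert.hyps by simp
      next
        case False
        then have "{i \<in> insert j I. f i = w} = {i\<in>I. f i = w}" by auto
        then show ?thesis using False by simp
      qed
      have "(\<Otimes>w\<in>F. w [^] card {i \<in> insert j I. f i = w})
          = (\<Otimes>w\<in>F. w [^] card {i\<in>I. f i = w} \<otimes> (if f j = w then w else \<one>))"
        using F(3) unfolding card by (intro finprod_cong') auto
      also have "\<dots> = (\<Otimes>w\<in>F. w [^] card {i\<in>I. f i = w}) \<otimes> (\<Otimes>w\<in>F. if f j = w then w else \<one>)"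
        using F(3) by (intro finprod_multf) auto
      also have "(\<Otimes>w\<in>F. if f j = w then w else \<one>) = f j"
        using finprod_singleton[of "f j" F "\<lambda>w. w"] F fj by auto
      also have "(\<Otimes>w\<in>F. w [^] card {i\<in>I. f i = w}) \<otimes> f j = f j \<otimes> (\<Otimes>i\<in>I. f i)"
      proof -
        have "(\<Otimes>i\<in>I. f i) \<in> carrier G" using fI F(3) by (intro finprod_closed) auto
        then show ?thesis using insert(3)[OF fI] fj F(3) m_comm by (metis subsetD)
      qed
      also have "\<dots> = (\<Otimes>i\<in>insert j I. f i)"
        using insert.hyps fI fj F(3) by (subst finprod_insert) auto
      finally have 1: "(\<Otimes>i\<in>insert j I. f i) = (\<Otimes>w\<in>F. w [^] card {i \<in> insert j I. f i = w})" by simp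
      have "(\<Sum>w\<in>F. card {i \<in> insert j I. f i = w}) = (\<Sum>w\<in>F. card {i\<in>I. f i = w}) + 1"
        unfolding card sum.distrib using F(1) fj by simp
      with 1 insert(3)[OF fI] insert.hyps show ?case by simp
    qed
    then have "\<forall>w\<in>F. w \<noteq> v \<longrightarrow> card {i\<in>I. f i = w} = 0" using eq by (intro ext) metis
    then show ?thesis using I f by fastforce
  qed
  then show ?thesis using v by blast
qed

end

context fg_nilpotent_group
begin

text \<open>At a vertex where \<open>d\<close> has an extreme value, all neighbours must share that
  value; as \<open>S\<close> generates \<open>G\<close>, it spreads along words to every
  vertex.\<close>

lemma harmonic_imp_constant:
  fixes Q (structure)
  assumes Q: "comm_group Q"
    and tf: "\<And>x n. x \<in> carrier Q \<Longrightarrow> n > (0::nat) \<Longrightarrow> x [^]\<^bsub>Q\<^esub> n = \<one>\<^bsub>Q\<^esub> \<Longrightarrow> x = \<one>\<^bsub>Q\<^esub>"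
    and d: "d \<in> carrier G \<rightarrow> carrier Q" and fin: "finite (d ` carrier G)"
    and harm: "\<And>x. x \<in> carrier G \<Longrightarrow> finprod Q (\<lambda>s. d (x \<otimes>\<^bsub>G\<^esub> s)) S = d x [^]\<^bsub>Q\<^esub> card S"
  shows "\<exists>v\<in>carrier Q. \<forall>x\<in>carrier G. d x = v"
proof -
  interpret Q: comm_group Q by fact
  have "d ` carrier G \<noteq> {}" "d ` carrier G \<subseteq> carrier Q" using d by auto
  then have "\<exists>v\<in>d ` carrier G. \<forall>I (f :: 'a \<Rightarrow> _). finite I \<longrightarrow>
      f \<in> I \<rightarrow> d ` carrier G \<longrightarrow> finprod Q f I = v [^]\<^bsub>Q\<^esub> card I \<longrightarrow> (\<forall>i\<in>I. f i = v)"
    using tf by (intro Q.exists_extreme_value[OF fin]) blast+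
  then obtain v where v: "v \<in> d ` carrier G" and "\<forall>I (f :: 'a \<Rightarrow> _). finite I \<longrightarrow>
      f \<in> I \<rightarrow> d ` carrier G \<longrightarrow> finprod Q f I = v [^]\<^bsub>Q\<^esub> card I \<longrightarrow> (\<forall>i\<in>I. f i = v)"
    by blast
  then have ext: "\<forall>i\<in>S. f i = v"
    if "f \<in> S \<rightarrow> d ` carrier G" "finprod Q f S = v [^]\<^bsub>Q\<^esub> card S" for f :: "'a \<Rightarrow> _"
    using finite_S that by blast
  from v obtain x0 where x0: "x0 \<in> carrier G" "d x0 = v" by blast
  have step: "d (x0 \<otimes>\<^bsub>G\<^esub> h) = v" if "h \<in> carrier G" for h
    using that
  proof (rule induct_right)
    fix h s assume h: "h \<in> carrier G" and s: "s \<in> S" and IH: "d (x0 \<otimes>\<^bsub>G\<^esub> h) = v"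
    have "\<forall>s\<in>S. d (x0 \<otimes>\<^bsub>G\<^esub> h \<otimes>\<^bsub>G\<^esub> s) = v"
      using harm[of "x0 \<otimes>\<^bsub>G\<^esub> h"] x0 h IH by (intro ext) auto
    then show "d (x0 \<otimes>\<^bsub>G\<^esub> (h \<otimes>\<^bsub>G\<^esub> s)) = v" using s h x0 by (simp add: m_assoc)
  qed (use x0 in simp)
  have "d x = v" if "x \<in> carrier G" for x
    using step[of "inv\<^bsub>G\<^esub> x0 \<otimes>\<^bsub>G\<^esub> x"] that x0 by (simp flip: m_assoc)
  then show ?thesis using d x0 by auto
qed

end

section \<open>Bounded automorphisms of Cayley graphs\<close>

context fg_nilpotent_group
begin

text \<open>Modulo the subgroup \<open>D\<close>, the permutation \<open>\<sigma> x\<close> of \<open>S\<close> is conjugation by \<open>E\<close>, which is trivial there.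
  Multiplying the displacements of \<open>\<sigma> x\<close> in \<open>D\<close> over all of \<open>S\<close> shows that \<open>d\<close> is harmonic.\<close>

lemma central_cocycle_constant:
  fixes Q (structure)
  assumes hom: "group_hom G Q p" and D: "subgroup D Q"
    and central: "\<And>z q. z \<in> D \<Longrightarrow> q \<in> carrier Q \<Longrightarrow> z \<otimes>\<^bsub>Q\<^esub> q = q \<otimes>\<^bsub>Q\<^esub> z"
    and tf: "\<And>z n. z \<in> D \<Longrightarrow> n > (0::nat) \<Longrightarrow> z [^]\<^bsub>Q\<^esub> n = \<one>\<^bsub>Q\<^esub> \<Longrightarrow> z = \<one>\<^bsub>Q\<^esub>"
    and E: "E \<in> carrier Q"
    and chi: "\<And>s. s \<in> S \<Longrightarrow> inv\<^bsub>Q\<^esub> p s \<otimes>\<^bsub>Q\<^esub> inv\<^bsub>Q\<^esub> E \<otimes>\<^bsub>Q\<^esub> p s \<otimes>\<^bsub>Q\<^esub> E \<in> D"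
    and d: "d \<in> carrier G \<rightarrow> D" and fin: "finite (d ` carrier G)"
    and bij: "\<And>x. x \<in> carrier G \<Longrightarrow> bij_betw (\<sigma> x) S S"
    and eqn: "\<And>x s. x \<in> carrier G \<Longrightarrow> s \<in> S \<Longrightarrow>
      p (\<sigma> x s) = inv\<^bsub>Q\<^esub> d x \<otimes>\<^bsub>Q\<^esub> inv\<^bsub>Q\<^esub> E \<otimes>\<^bsub>Q\<^esub> p s \<otimes>\<^bsub>Q\<^esub> E \<otimes>\<^bsub>Q\<^esub> d (x \<otimes>\<^bsub>G\<^esub> s)"
  shows "\<exists>v\<in>D. \<forall>x\<in>carrier G. d x = v"
proof -
  interpret p: group_hom G Q p by (rule hom)
  have Dc: "z \<in> carrier Q" if "z \<in> D" for z using that D subgroup.mem_carrier by metis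
  \<comment> \<open>\<open>Q\<close> may be noncommutative; finite products are formed in the
    central subgroup \<open>D\<close>.\<close>
  define C where "C = Q\<lparr>carrier := D\<rparr>"
  have Cs [simp]: "carrier C = D" "x \<otimes>\<^bsub>C\<^esub> y = x \<otimes>\<^bsub>Q\<^esub> y" "\<one>\<^bsub>C\<^esub> = \<one>\<^bsub>Q\<^esub>"
    "x [^]\<^bsub>C\<^esub> n = x [^]\<^bsub>Q\<^esub> n" for x y and n :: nat
    unfolding C_def using p.H.nat_pow_consistent by auto
  interpret C: comm_group C
  proof (rule group.group_comm_groupI)
    show "group C" unfolding C_def by (rule subgroup.subgroup_is_group[OF D p.H.is_group])
    fix x y assume "x \<in> carrier C" "y \<in> carrier C"
    then show "x \<otimes>\<^bsub>C\<^esub> y = y \<otimes>\<^bsub>C\<^esub> x" using central[of x y] Dc by simp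
  qed
  have tfC: "x = \<one>\<^bsub>C\<^esub>" if "x \<in> carrier C" "n > 0" "x [^]\<^bsub>C\<^esub> n = \<one>\<^bsub>C\<^esub>" for x and n :: nat
    using tf[of x n] that by simp
  define \<chi> where "\<chi> s = inv\<^bsub>Q\<^esub> p s \<otimes>\<^bsub>Q\<^esub> inv\<^bsub>Q\<^esub> E \<otimes>\<^bsub>Q\<^esub> p s \<otimes>\<^bsub>Q\<^esub> E" for s
  have chiD: "\<chi> s \<in> D" if "s \<in> S" for s using chi that unfolding \<chi>_def by simp
  have conj: "inv\<^bsub>Q\<^esub> E \<otimes>\<^bsub>Q\<^esub> p s \<otimes>\<^bsub>Q\<^esub> E = p s \<otimes>\<^bsub>Q\<^esub> \<chi> s" if "s \<in> S" for s
    using that E unfolding \<chi>_def by (simp flip: p.H.m_assoc)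
  have chi_inv: "\<chi> s \<otimes>\<^bsub>Q\<^esub> \<chi> (inv\<^bsub>G\<^esub> s) = \<one>\<^bsub>Q\<^esub>" if s: "s \<in> S" for s
  proof -
    have sc: "s \<in> carrier G" "p s \<in> carrier Q" and si: "inv\<^bsub>G\<^esub> s \<in> S" using s inv_mem_S by auto
    have cc: "\<chi> s \<in> carrier Q" "\<chi> (inv\<^bsub>G\<^esub> s) \<in> carrier Q" using chiD s si Dc by auto
    have "(inv\<^bsub>Q\<^esub> E \<otimes>\<^bsub>Q\<^esub> p s \<otimes>\<^bsub>Q\<^esub> E) \<otimes>\<^bsub>Q\<^esub> (inv\<^bsub>Q\<^esub> E \<otimes>\<^bsub>Q\<^esub> inv\<^bsub>Q\<^esub> p s \<otimes>\<^bsub>Q\<^esub> E) = \<one>\<^bsub>Q\<^esub>"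
      using E sc by (metis p.H.inv_closed p.H.inv_inv p.H.inv_mult_group p.H.m_assoc p.H.m_closed p.H.r_inv)
    then have "(p s \<otimes>\<^bsub>Q\<^esub> \<chi> s) \<otimes>\<^bsub>Q\<^esub> (inv\<^bsub>Q\<^esub> p s \<otimes>\<^bsub>Q\<^esub> \<chi> (inv\<^bsub>G\<^esub> s)) = \<one>\<^bsub>Q\<^esub>"
      using conj[OF s] conj[OF si] sc by simp
    moreover have "(p s \<otimes>\<^bsub>Q\<^esub> \<chi> s) \<otimes>\<^bsub>Q\<^esub> (inv\<^bsub>Q\<^esub> p s \<otimes>\<^bsub>Q\<^esub> \<chi> (inv\<^bsub>G\<^esub> s))
        = \<chi> s \<otimes>\<^bsub>Q\<^esub> (p s \<otimes>\<^bsub>Q\<^esub> inv\<^bsub>Q\<^esub> p s) \<otimes>\<^bsub>Q\<^esub> \<chi> (inv\<^bsub>G\<^esub> s)"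
      using central[OF chiD[OF s], of "p s"] sc cc by (simp only: p.H.m_assoc p.H.m_closed p.H.inv_closed)
        (metis p.H.inv_closed p.H.m_assoc p.H.m_closed)
    ultimately show ?thesis using sc cc by simp
  qed
  \<comment> \<open>Inversion permutes \<open>S\<close> and sends the values of
    \<open>\<chi>\<close> to their inverses, so the square of the product is trivial;
    torsion-freeness removes the square.\<close>
  have chi_prod: "finprod C \<chi> S = \<one>\<^bsub>C\<^esub>"
  proof -
    have c: "\<chi> \<in> S \<rightarrow> carrier C" using chiD by auto
    then have c': "(\<lambda>s. \<chi> (inv\<^bsub>G\<^esub> s)) \<in> S \<rightarrow> carrier C" using inv_mem_S by auto
    have im: "(\<lambda>s. inv\<^bsub>G\<^esub> s) ` S = S"
      using inv_mem_S by (force intro: rev_image_eqI[of "inv\<^bsub>G\<^esub> _"])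
    have inj: "inj_on (\<lambda>s. inv\<^bsub>G\<^esub> s) S" by (rule inj_onI) (metis inv_inv S_closed)
    have "finprod C \<chi> S = finprod C (\<lambda>s. \<chi> (inv\<^bsub>G\<^esub> s)) S"
      using C.finprod_reindex[of \<chi> "\<lambda>s. inv\<^bsub>G\<^esub> s" S] c im inj by simp
    then have "finprod C \<chi> S [^]\<^bsub>C\<^esub> (2::nat) = finprod C \<chi> S \<otimes>\<^bsub>C\<^esub> finprod C (\<lambda>s. \<chi> (inv\<^bsub>G\<^esub> s)) S"
      using c C.finprod_closed[OF c] by (simp add: numeral_2_eq_2 del: Cs)
    also have "\<dots> = finprod C (\<lambda>s. \<chi> s \<otimes>\<^bsub>C\<^esub> \<chi> (inv\<^bsub>G\<^esub> s)) S"
      using c c' by (rule C.finprod_multf[symmetric])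
    also have "\<dots> = \<one>\<^bsub>C\<^esub>" by (rule C.finprod_one_eqI) (simp add: chi_inv)
    finally show ?thesis by (rule tfC[OF C.finprod_closed[OF c] zero_less_numeral])
  qed
  \<comment> \<open>\<open>r\<close> picks a representative of each coset of \<open>D\<close> and
    \<open>u\<close> is the remaining \<open>D\<close>-component. Since \<open>p s\<close> and its
    permuted image lie in the same coset, comparing their \<open>u\<close>-values measures the
    displacement inside \<open>D\<close>.\<close>
  define r where "r q = (SOME y. y \<in> carrier Q \<and> inv\<^bsub>Q\<^esub> y \<otimes>\<^bsub>Q\<^esub> q \<in> D)" for q
  define u where "u q = inv\<^bsub>Q\<^esub> r q \<otimes>\<^bsub>Q\<^esub> q" for q
  have r: "r q \<in> carrier Q \<and> u q \<in> D" if "q \<in> carrier Q" for q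
    unfolding r_def u_def by (rule someI[of _ q]) (use that subgroup.one_closed[OF D] in simp)
  have r_eq: "r (q \<otimes>\<^bsub>Q\<^esub> z) = r q" if q: "q \<in> carrier Q" and z: "z \<in> D" for q z
  proof -
    have "inv\<^bsub>Q\<^esub> y \<otimes>\<^bsub>Q\<^esub> (q \<otimes>\<^bsub>Q\<^esub> z) \<in> D \<longleftrightarrow> inv\<^bsub>Q\<^esub> y \<otimes>\<^bsub>Q\<^esub> q \<in> D" if y: "y \<in> carrier Q" for y
    proof
      assume "inv\<^bsub>Q\<^esub> y \<otimes>\<^bsub>Q\<^esub> (q \<otimes>\<^bsub>Q\<^esub> z) \<in> D"
      then have "inv\<^bsub>Q\<^esub> y \<otimes>\<^bsub>Q\<^esub> (q \<otimes>\<^bsub>Q\<^esub> z) \<otimes>\<^bsub>Q\<^esub> inv\<^bsub>Q\<^esub> z \<in> D"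
        by (rule subgroup.m_closed[OF D _ subgroup.m_inv_closed[OF D z]])
      then show "inv\<^bsub>Q\<^esub> y \<otimes>\<^bsub>Q\<^esub> q \<in> D" using q y Dc[OF z] by (simp add: p.H.m_assoc)
    next
      assume "inv\<^bsub>Q\<^esub> y \<otimes>\<^bsub>Q\<^esub> q \<in> D"
      then have "inv\<^bsub>Q\<^esub> y \<otimes>\<^bsub>Q\<^esub> q \<otimes>\<^bsub>Q\<^esub> z \<in> D" by (rule subgroup.m_closed[OF D _ z])
      then show "inv\<^bsub>Q\<^esub> y \<otimes>\<^bsub>Q\<^esub> (q \<otimes>\<^bsub>Q\<^esub> z) \<in> D" using q y Dc[OF z] by (simp add: p.H.m_assoc)
    qed
    then show ?thesis unfolding r_def by metis
  qed
  have harm: "finprod C (\<lambda>s. d (x \<otimes>\<^bsub>G\<^esub> s)) S = d x [^]\<^bsub>C\<^esub> card S" if x: "x \<in> carrier G" for x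
  proof -
    have dxs: "d (x \<otimes>\<^bsub>G\<^esub> s) \<in> D" if "s \<in> S" for s using d x that by auto
    have dx: "d x \<in> D" using d x by auto
    have sig: "\<sigma> x s \<in> S" if "s \<in> S" for s using bij[OF x] that bij_betwE by blast
    have uD: "u (p s) \<in> D" if "s \<in> S" for s using r[of "p s"] that by simp
    have key: "u (p s) \<otimes>\<^bsub>Q\<^esub> \<chi> s \<otimes>\<^bsub>Q\<^esub> d (x \<otimes>\<^bsub>G\<^esub> s) = u (p (\<sigma> x s)) \<otimes>\<^bsub>Q\<^esub> d x" if s: "s \<in> S" for s
    proof -
      have c: "p s \<in> carrier Q" "\<chi> s \<in> carrier Q" "d x \<in> carrier Q" "d (x \<otimes>\<^bsub>G\<^esub> s) \<in> carrier Q"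
        "r (p s) \<in> carrier Q"
        using s chiD Dc dx dxs r by auto
      have "p (\<sigma> x s) = inv\<^bsub>Q\<^esub> d x \<otimes>\<^bsub>Q\<^esub> (inv\<^bsub>Q\<^esub> E \<otimes>\<^bsub>Q\<^esub> p s \<otimes>\<^bsub>Q\<^esub> E) \<otimes>\<^bsub>Q\<^esub> d (x \<otimes>\<^bsub>G\<^esub> s)"
        using eqn[OF x s] c E by (simp add: p.H.m_assoc)
      also have "\<dots> = inv\<^bsub>Q\<^esub> d x \<otimes>\<^bsub>Q\<^esub> (p s \<otimes>\<^bsub>Q\<^esub> \<chi> s \<otimes>\<^bsub>Q\<^esub> d (x \<otimes>\<^bsub>G\<^esub> s))"
        unfolding conj[OF s] using c by (simp add: p.H.m_assoc)
      also have "\<dots> = p s \<otimes>\<^bsub>Q\<^esub> \<chi> s \<otimes>\<^bsub>Q\<^esub> d (x \<otimes>\<^bsub>G\<^esub> s) \<otimes>\<^bsub>Q\<^esub> inv\<^bsub>Q\<^esub> d x"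
        using c by (intro central subgroup.m_inv_closed[OF D dx]) simp
      finally have ps: "p (\<sigma> x s) = p s \<otimes>\<^bsub>Q\<^esub> \<chi> s \<otimes>\<^bsub>Q\<^esub> d (x \<otimes>\<^bsub>G\<^esub> s) \<otimes>\<^bsub>Q\<^esub> inv\<^bsub>Q\<^esub> d x" .
      have "p (\<sigma> x s) = p s \<otimes>\<^bsub>Q\<^esub> (\<chi> s \<otimes>\<^bsub>Q\<^esub> d (x \<otimes>\<^bsub>G\<^esub> s) \<otimes>\<^bsub>Q\<^esub> inv\<^bsub>Q\<^esub> d x)"
        unfolding ps using c by (simp add: p.H.m_assoc)
      moreover have "\<chi> s \<otimes>\<^bsub>Q\<^esub> d (x \<otimes>\<^bsub>G\<^esub> s) \<otimes>\<^bsub>Q\<^esub> inv\<^bsub>Q\<^esub> d x \<in> D"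
        by (intro subgroup.m_closed[OF D] subgroup.m_inv_closed[OF D] chiD dx dxs s)
      ultimately have req: "r (p (\<sigma> x s)) = r (p s)" using r_eq c by simp
      have "u (p (\<sigma> x s)) \<otimes>\<^bsub>Q\<^esub> d x = inv\<^bsub>Q\<^esub> r (p s) \<otimes>\<^bsub>Q\<^esub> p (\<sigma> x s) \<otimes>\<^bsub>Q\<^esub> d x"
        unfolding u_def req ..
      also have "\<dots> = u (p s) \<otimes>\<^bsub>Q\<^esub> \<chi> s \<otimes>\<^bsub>Q\<^esub> d (x \<otimes>\<^bsub>G\<^esub> s)"
        unfolding ps u_def using c by (simp add: p.H.m_assoc)
      finally show ?thesis by simp
    qed
    let ?U = "finprod C (\<lambda>s. u (p s)) S"
    let ?X = "finprod C (\<lambda>s. d (x \<otimes>\<^bsub>G\<^esub> s)) S"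
    have c1: "(\<lambda>s. u (p s)) \<in> S \<rightarrow> carrier C" "\<chi> \<in> S \<rightarrow> carrier C"
      "(\<lambda>s. d (x \<otimes>\<^bsub>G\<^esub> s)) \<in> S \<rightarrow> carrier C" "(\<lambda>s. u (p (\<sigma> x s))) \<in> S \<rightarrow> carrier C" "(\<lambda>s. d x) \<in> S \<rightarrow> carrier C"
      using uD chiD dxs sig dx by auto
    have c2: "(\<lambda>s. u (p s) \<otimes>\<^bsub>C\<^esub> \<chi> s) \<in> S \<rightarrow> carrier C" using c1 C.m_closed by (simp add: Pi_iff)
    have UX: "?U \<in> carrier C" "?X \<in> carrier C"
      by (rule C.finprod_closed[OF c1(1)], rule C.finprod_closed[OF c1(3)])
    \<comment> \<open>Over all of \<open>S\<close> the product of the \<open>u\<close>-values is the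
      same on both sides of \<open>key\<close>, because \<open>\<sigma> x\<close> is a permutation;
      it cancels and leaves harmonicity.\<close>
    have "finprod C (\<lambda>s. u (p s) \<otimes>\<^bsub>C\<^esub> \<chi> s \<otimes>\<^bsub>C\<^esub> d (x \<otimes>\<^bsub>G\<^esub> s)) S = ?U \<otimes>\<^bsub>C\<^esub> finprod C \<chi> S \<otimes>\<^bsub>C\<^esub> ?X"
      using C.finprod_multf[OF c2 c1(3)] C.finprod_multf[OF c1(1,2)] by simp
    then have "?U \<otimes>\<^bsub>C\<^esub> ?X = finprod C (\<lambda>s. u (p s) \<otimes>\<^bsub>C\<^esub> \<chi> s \<otimes>\<^bsub>C\<^esub> d (x \<otimes>\<^bsub>G\<^esub> s)) S"
      unfolding chi_prod using UX C.r_one by metis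
    also have "\<dots> = finprod C (\<lambda>s. u (p (\<sigma> x s)) \<otimes>\<^bsub>C\<^esub> d x) S"
      using key c1 by (intro C.finprod_cong') (auto intro!: subgroup.m_closed[OF D])
    also have "\<dots> = finprod C (\<lambda>s. u (p (\<sigma> x s))) S \<otimes>\<^bsub>C\<^esub> finprod C (\<lambda>s. d x) S"
      by (rule C.finprod_multf[OF c1(4,5)])
    also have "finprod C (\<lambda>s. u (p (\<sigma> x s))) S = ?U"
      using C.finprod_reindex[of "\<lambda>s. u (p s)" "\<sigma> x" S] bij[OF x] c1(1) unfolding bij_betw_def by simp
    also have "finprod C (\<lambda>s. d x) S = d x [^]\<^bsub>C\<^esub> card S"
      by (rule C.finprod_const) (use dx in simp)
    finally show ?thesis using UX dx[folded Cs(1)] by (simp del: Cs)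
  qed
  show ?thesis
    using harmonic_imp_constant[OF C.comm_group_axioms _ _ fin harm] tfC d by (simp del: Cs(2-4))
qed


section \<open>The quotients by the terms of the series\<close>

lemma ser_commutator:
  "a \<in> ser (Suc j) \<Longrightarrow> b \<in> carrier G \<Longrightarrow> a \<otimes> b \<otimes> inv a \<otimes> inv b \<in> ser j"
  by (simp add: central_modulo_def)

text \<open>The projections are kept opaque so that the simplifier does not rewrite products in the quotient
  to products of sets.\<close>

definition Qt :: "nat \<Rightarrow> 'a set monoid" where "Qt i = G Mod ser i"

definition pr :: "nat \<Rightarrow> 'a \<Rightarrow> 'a set" where "pr i x = ser i #> x"

lemma pr_hom: "group_hom G (Qt i) (pr i)"
proof -
  interpret K: normal "ser i" G by (rule ser_normal)
  have "pr i = (\<lambda>x. ser i #> x)" by (rule ext) (rule pr_def)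
  then show ?thesis
    unfolding Qt_def group_hom_def group_hom_axioms_def
    using K.factorgroup_is_group K.r_coset_hom_Mod is_group by simp
qed

sublocale pr: group_hom G "Qt i" "pr i" for i
  by (rule pr_hom)

lemma carrier_Qt: "carrier (Qt i) = pr i ` carrier G"
  unfolding Qt_def pr_def by (rule carrier_FactGroup)

lemma pr_eq_one_iff: "x \<in> carrier G \<Longrightarrow> pr i x = \<one>\<^bsub>Qt i\<^esub> \<longleftrightarrow> x \<in> ser i"
  unfolding Qt_def pr_def one_FactGroup
  using coset_join1[of "ser i" x] coset_join2[of x "ser i"] normal_imp_subgroup[OF ser_normal] by blast

lemma pr_eq_iff:
  assumes "x \<in> carrier G" "y \<in> carrier G"
  shows "pr i x = pr i y \<longleftrightarrow> inv x \<otimes> y \<in> ser i"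
proof -
  have "pr i x = pr i y \<longleftrightarrow> pr i (inv x \<otimes> y) = \<one>\<^bsub>Qt i\<^esub>"
    using assms by (metis pr.H.inv_closed pr.H.inv_equality pr.H.inv_inv pr.H.l_inv pr.hom_closed pr.hom_inv
        pr.hom_mult inv_closed)
  then show ?thesis using pr_eq_one_iff[of "inv x \<otimes> y" i] assms by simp
qed

lemma pr_central:
  assumes "z \<in> pr j ` ser (Suc j)" "q \<in> carrier (Qt j)"
  shows "z \<otimes>\<^bsub>Qt j\<^esub> q = q \<otimes>\<^bsub>Qt j\<^esub> z"
proof -
  obtain a b where a: "a \<in> ser (Suc j)" "z = pr j a" and b: "b \<in> carrier G" "q = pr j b"
    using assms carrier_Qt by blast
  have "a \<otimes> b \<otimes> inv a \<otimes> inv b \<in> ser j" using a(1) b(1) by (rule ser_commutator)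
  then show ?thesis
    using pr_eq_one_iff[of "a \<otimes> b \<otimes> inv a \<otimes> inv b" j] ser_closed[OF a(1)] a b
      pr.H.commutator_eq_one_iff[of "pr j a" j "pr j b"] by simp
qed

lemma pr_torsion_free:
  assumes "z \<in> carrier (Qt j)" "m > (0::nat)" "z [^]\<^bsub>Qt j\<^esub> m = \<one>\<^bsub>Qt j\<^esub>"
  shows "z = \<one>\<^bsub>Qt j\<^esub>"
proof -
  obtain a where a: "a \<in> carrier G" "z = pr j a" using assms carrier_Qt by blast
  then have "pr j (a [^] m) = \<one>\<^bsub>Qt j\<^esub>" using assms by (simp add: pr.hom_nat_pow)
  then have "a [^] m \<in> ser j" using pr_eq_one_iff a by simp
  then have "a \<in> ser j" by (rule ser_root[OF a(1) assms(2)])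
  then show ?thesis using pr_eq_one_iff a by simp
qed

text \<open>Conjugation by \<open>e\<close> maps a finite generating set of the quotient into
  itself, so two of its powers agree there. A positive power of \<open>e\<close> is therefore
  central, and \<open>ser_root\<close> passes to \<open>e\<close>.\<close>

lemma conj_permutes_generators_imp_central:
  assumes e: "e \<in> carrier G"
    and conj: "\<And>s. s \<in> S \<Longrightarrow> \<exists>t\<in>S. inv t \<otimes> (inv e \<otimes> s \<otimes> e) \<in> ser j"
  shows "e \<in> ser (Suc j)"
proof -
  define E where "E = pr j e"
  define T where "T = pr j ` S"
  have E: "E \<in> carrier (Qt j)" unfolding E_def using e by simp
  have T: "T \<subseteq> carrier (Qt j)" "finite T" unfolding T_def using finite_S by auto
  define c where "c m t = inv\<^bsub>Qt j\<^esub> (E [^]\<^bsub>Qt j\<^esub> m) \<otimes>\<^bsub>Qt j\<^esub> t \<otimes>\<^bsub>Qt j\<^esub> E [^]\<^bsub>Qt j\<^esub> m" for m :: nat and t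
  have c1: "inv\<^bsub>Qt j\<^esub> E \<otimes>\<^bsub>Qt j\<^esub> t \<otimes>\<^bsub>Qt j\<^esub> E \<in> T" if t: "t \<in> T" for t
  proof -
    obtain s where s: "s \<in> S" "t = pr j s" using t unfolding T_def by blast
    obtain s' where s': "s' \<in> S" "inv s' \<otimes> (inv e \<otimes> s \<otimes> e) \<in> ser j" using conj[OF s(1)] by blast
    then have "pr j s' = pr j (inv e \<otimes> s \<otimes> e)" using pr_eq_iff[of s' "inv e \<otimes> s \<otimes> e"] e s by simp
    then show ?thesis using s s' e unfolding E_def T_def by auto
  qed
  have cT: "c m t \<in> T" if "t \<in> T" for m t
  proof (induct m)
    case 0
    then show ?case using that T unfolding c_def by auto
  next
    case (Suc m)
    have t: "t \<in> carrier (Qt j)" using that T by blast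
    have "c (Suc m) t = inv\<^bsub>Qt j\<^esub> E \<otimes>\<^bsub>Qt j\<^esub> c m t \<otimes>\<^bsub>Qt j\<^esub> E"
      unfolding c_def using E t by (simp add: pr.H.m_assoc pr.H.inv_mult_group)
    then show ?case using c1[OF Suc] by simp
  qed
  \<comment> \<open>Pigeonhole on the finitely many maps from \<open>T\<close> to itself;
    \<open>restrict\<close> discards the values outside \<open>T\<close>.\<close>
  have "finite (range (\<lambda>m. restrict (c m) T))"
  proof (rule finite_subset)
    show "range (\<lambda>m. restrict (c m) T) \<subseteq> T \<rightarrow>\<^sub>E T" using cT by auto
    show "finite (T \<rightarrow>\<^sub>E T)" using T(2) by (intro finite_PiE) auto
  qed
  then have "\<not> inj (\<lambda>m. restrict (c m) T)" using finite_imageD infinite_UNIV_nat by blast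
  then obtain m n where "m < n" and mn: "restrict (c m) T = restrict (c n) T"
    unfolding inj_def by (metis nat_neq_iff)
  define k where "k = n - m"
  have k: "k > 0" "n = k + m" using \<open>m < n\<close> unfolding k_def by auto
  have "S \<subseteq> {y \<in> carrier G. e [^] k \<otimes> y \<otimes> inv (e [^] k) \<otimes> inv y \<in> ser j}"
  proof
    fix s assume s: "s \<in> S"
    have t: "pr j s \<in> T" "pr j s \<in> carrier (Qt j)" using s T unfolding T_def by auto
    have "c m (pr j s) = c n (pr j s)" using mn t by (metis restrict_apply')
    also have "\<dots> = inv\<^bsub>Qt j\<^esub> (E [^]\<^bsub>Qt j\<^esub> m) \<otimes>\<^bsub>Qt j\<^esub> c k (pr j s) \<otimes>\<^bsub>Qt j\<^esub> E [^]\<^bsub>Qt j\<^esub> m"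
      unfolding c_def k(2) using E t
      by (simp add: pr.H.nat_pow_mult[symmetric] pr.H.m_assoc pr.H.inv_mult_group)
    finally have "inv\<^bsub>Qt j\<^esub> (E [^]\<^bsub>Qt j\<^esub> m) \<otimes>\<^bsub>Qt j\<^esub> (pr j s \<otimes>\<^bsub>Qt j\<^esub> E [^]\<^bsub>Qt j\<^esub> m) = inv\<^bsub>Qt j\<^esub> (E [^]\<^bsub>Qt j\<^esub> m) \<otimes>\<^bsub>Qt j\<^esub> (c k (pr j s) \<otimes>\<^bsub>Qt j\<^esub> E [^]\<^bsub>Qt j\<^esub> m)"
      unfolding c_def using E t by (simp add: pr.H.m_assoc)
    then have "pr j s = c k (pr j s)"
      using E t cT[OF t(1), of k] T(1) by auto
    then have "E [^]\<^bsub>Qt j\<^esub> k \<otimes>\<^bsub>Qt j\<^esub> pr j s = E [^]\<^bsub>Qt j\<^esub> k \<otimes>\<^bsub>Qt j\<^esub> c k (pr j s)" by simp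
    also have "\<dots> = pr j s \<otimes>\<^bsub>Qt j\<^esub> E [^]\<^bsub>Qt j\<^esub> k"
      unfolding c_def using E t by (simp flip: pr.H.m_assoc)
    finally have "pr j (e [^] k) \<otimes>\<^bsub>Qt j\<^esub> pr j s = pr j s \<otimes>\<^bsub>Qt j\<^esub> pr j (e [^] k)"
      unfolding E_def using e by (simp add: pr.hom_nat_pow)
    then have "pr j (e [^] k \<otimes> s \<otimes> inv (e [^] k) \<otimes> inv s) = \<one>\<^bsub>Qt j\<^esub>"
      using pr.H.commutator_eq_one_iff[of "pr j (e [^] k)" j "pr j s"] e s by simp
    then show "s \<in> {y \<in> carrier G. e [^] k \<otimes> y \<otimes> inv (e [^] k) \<otimes> inv y \<in> ser j}"
      using pr_eq_one_iff[of "e [^] k \<otimes> s \<otimes> inv (e [^] k) \<otimes> inv s"] e s by auto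
  qed
  then have "generate G S \<subseteq> {y \<in> carrier G. e [^] k \<otimes> y \<otimes> inv (e [^] k) \<otimes> inv y \<in> ser j}"
    by (rule generate_subgroup_incl[OF _ centralizer_modulo_subgroup[OF ser_normal nat_pow_closed[OF e]]])
  then have "e [^] k \<in> ser (Suc j)"
    using nat_pow_closed[OF e] unfolding upper_central_series.simps central_modulo_def generate_S by blast
  then show ?thesis using ser_root[OF e k(1)] by blast
qed

text \<open>A descent in which \<open>central_cocycle_constant\<close> refines the constant by one
  level at a time. \<open>bij\<close> says that at each vertex neighbours go bijectively to
  neighbours, and \<open>B\<close> bounds the displacement.\<close>

lemma bounded_automorphism_constant:
  assumes psi: "\<psi> \<in> carrier G \<rightarrow> carrier G"
    and bij: "\<And>x. x \<in> carrier G \<Longrightarrow> bij_betw (\<lambda>s. inv (\<psi> x) \<otimes> \<psi> (x \<otimes> s)) S S"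
    and B: "finite B" "B \<subseteq> carrier G"
      "\<And>x. x \<in> carrier G \<Longrightarrow> \<exists>b\<in>B. inv b \<otimes> (inv x \<otimes> \<psi> x) \<in> ser i"
  shows "\<exists>e\<in>ser (Suc i). \<forall>x\<in>carrier G. inv e \<otimes> (inv x \<otimes> \<psi> x) \<in> ser i"
proof -
  define c where "c x = inv x \<otimes> \<psi> x" for x
  have c: "c x \<in> carrier G" if "x \<in> carrier G" for x using that psi unfolding c_def by auto
  have step: "inv (\<psi> x) \<otimes> \<psi> (x \<otimes> s) = inv (c x) \<otimes> s \<otimes> c (x \<otimes> s)"
    if "x \<in> carrier G" "s \<in> carrier G" for x s
  proof -
    have "\<psi> x \<in> carrier G" "\<psi> (x \<otimes> s) \<in> carrier G" using that psi by auto
    then show ?thesis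
      unfolding c_def using that by (simp add: inv_mult_group m_assoc) (simp flip: m_assoc)
  qed
  have sig: "inv (c x) \<otimes> s \<otimes> c (x \<otimes> s) \<in> S" if "x \<in> carrier G" "s \<in> S" for x s
    using bij[OF that(1)] that(2) step[OF that(1), of s] bij_betwE by fastforce
  \<comment> \<open>Modulo \<open>ser j\<close>, the permutation of \<open>S\<close> seen at the
    vertex \<open>\<one>\<close> is conjugation by \<open>e\<close>.\<close>
  have central: "e \<in> ser (Suc j)"
    if e: "e \<in> carrier G" and const: "\<And>x. x \<in> carrier G \<Longrightarrow> inv e \<otimes> c x \<in> ser j" for e j
  proof (rule conj_permutes_generators_imp_central[OF e])
    fix s assume s: "s \<in> S"
    have pc: "pr j (c x) = pr j e" if "x \<in> carrier G" for x
      using pr_eq_iff[of e "c x"] const c e that by auto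
    let ?t = "inv (c \<one>) \<otimes> s \<otimes> c s"
    have t: "?t \<in> S" using sig[of \<one> s] s by simp
    have "pr j ?t = pr j (inv e \<otimes> s \<otimes> e)"
      using pc s e c[of \<one>] c[of s] by simp
    then have "inv ?t \<otimes> (inv e \<otimes> s \<otimes> e) \<in> ser j"
      using pr_eq_iff[of ?t "inv e \<otimes> s \<otimes> e"] t s e by auto
    then show "\<exists>t\<in>S. inv t \<otimes> (inv e \<otimes> s \<otimes> e) \<in> ser j" using t by blast
  qed
  obtain n where n: "ser n = carrier G" using ser_eq_carrier by blast
  have "l \<le> n \<Longrightarrow> i \<le> n - l \<Longrightarrow> \<exists>e\<in>carrier G. \<forall>x\<in>carrier G. inv e \<otimes> c x \<in> ser (n - l)" for l
  proof (induct l)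
    case 0
    then show ?case using n c by (intro bexI[of _ \<one>]) auto
  next
    case (Suc l)
    define j where "j = n - Suc l"
    have j: "n - l = Suc j" "i \<le> j" using Suc.prems unfolding j_def by auto
    obtain e where e: "e \<in> carrier G" and const: "\<And>x. x \<in> carrier G \<Longrightarrow> inv e \<otimes> c x \<in> ser (Suc j)"
      using Suc j by auto
    \<comment> \<open>It follows that commutators of \<open>e\<close> with generators lie in
      \<open>ser (Suc j)\<close>, which gives the premise \<open>chi\<close> of
      \<open>central_cocycle_constant\<close>.\<close>
    have e2: "e \<in> ser (Suc (Suc j))" by (rule central[OF e const])
    interpret K1: normal "ser (Suc j)" G by (rule ser_normal)
    interpret K2: normal "ser (Suc (Suc j))" G by (rule ser_normal)
    \<comment> \<open>The error of the constant \<open>e\<close> one level further down. Once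
      \<open>d\<close> is known to be the class of some \<open>v\<close>, the refined constant is
      \<open>e v\<close>.\<close>
    define d where "d x = pr j (inv e \<otimes> c x)" for x
    have pc: "pr j (c x) = pr j e \<otimes>\<^bsub>Qt j\<^esub> d x" if "x \<in> carrier G" for x
      using that c e unfolding d_def by (simp flip: pr.H.m_assoc)
    have "\<exists>v\<in>pr j ` ser (Suc j). \<forall>x\<in>carrier G. d x = v"
    proof (rule central_cocycle_constant[OF pr_hom, where E = "pr j e" and \<sigma> = "\<lambda>x s. inv (\<psi> x) \<otimes> \<psi> (x \<otimes> s)"])
      show "subgroup (pr j ` ser (Suc j)) (Qt j)"
        by (rule pr.subgroup_img_is_subgroup[OF K1.subgroup_axioms])
      fix z q assume "z \<in> pr j ` ser (Suc j)" "q \<in> carrier (Qt j)"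
      then show "z \<otimes>\<^bsub>Qt j\<^esub> q = q \<otimes>\<^bsub>Qt j\<^esub> z" by (rule pr_central)
    next
      fix z and m :: nat
      assume z: "z \<in> pr j ` ser (Suc j)" and m: "m > 0" "z [^]\<^bsub>Qt j\<^esub> m = \<one>\<^bsub>Qt j\<^esub>"
      have "z \<in> carrier (Qt j)" using z K1.subset unfolding carrier_Qt by blast
      then show "z = \<one>\<^bsub>Qt j\<^esub>" using m by (rule pr_torsion_free)
    next
      show "pr j e \<in> carrier (Qt j)" using e by simp
    next
      fix s assume s: "s \<in> S"
      have "inv e \<otimes> inv s \<otimes> inv (inv e) \<otimes> inv (inv s) \<in> ser (Suc j)"
        using s by (intro ser_commutator K2.m_inv_closed[OF e2] inv_closed S_closed)
      then have "inv s \<otimes> inv e \<otimes> inv (inv s) \<otimes> inv (inv e) \<in> ser (Suc j)"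
        using commutator_mem_sym[OF K1.subgroup_axioms, of "inv e" "inv s"] s e by simp
      then have "pr j (inv s \<otimes> inv e \<otimes> inv (inv s) \<otimes> inv (inv e)) \<in> pr j ` ser (Suc j)" by (rule imageI)
      then show "inv\<^bsub>Qt j\<^esub> pr j s \<otimes>\<^bsub>Qt j\<^esub> inv\<^bsub>Qt j\<^esub> pr j e \<otimes>\<^bsub>Qt j\<^esub> pr j s \<otimes>\<^bsub>Qt j\<^esub> pr j e \<in> pr j ` ser (Suc j)"
        using s e by simp
    next
      show "d \<in> carrier G \<rightarrow> pr j ` ser (Suc j)" unfolding d_def using const by auto
    next
      have "d ` carrier G \<subseteq> (\<lambda>b. inv\<^bsub>Qt j\<^esub> pr j e \<otimes>\<^bsub>Qt j\<^esub> pr j b) ` B"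
      proof
        fix y assume "y \<in> d ` carrier G"
        then obtain x where x: "x \<in> carrier G" "y = d x" by blast
        obtain b where b: "b \<in> B" "inv b \<otimes> c x \<in> ser i" using B(3)[OF x(1)] unfolding c_def by blast
        then have "inv b \<otimes> c x \<in> ser j"
          using upper_central_series_mono[OF torsion_normal j(2)] by blast
        then have "pr j b = pr j (c x)" using pr_eq_iff[of b "c x"] b B(2) c x by auto
        then have "y = inv\<^bsub>Qt j\<^esub> pr j e \<otimes>\<^bsub>Qt j\<^esub> pr j b" using x e c unfolding d_def by simp
        then show "y \<in> (\<lambda>b. inv\<^bsub>Qt j\<^esub> pr j e \<otimes>\<^bsub>Qt j\<^esub> pr j b) ` B" using b by blast
      qed
      then show "finite (d ` carrier G)" using B(1) finite_surj by blast
    next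
      fix x assume "x \<in> carrier G"
      then show "bij_betw (\<lambda>s. inv (\<psi> x) \<otimes> \<psi> (x \<otimes> s)) S S" by (rule bij)
    next
      fix x s assume x: "x \<in> carrier G" and s: "s \<in> S"
      have dc: "d x \<in> carrier (Qt j)" "d (x \<otimes> s) \<in> carrier (Qt j)" unfolding d_def using x s c e by auto
      have "pr j (inv (\<psi> x) \<otimes> \<psi> (x \<otimes> s)) = inv\<^bsub>Qt j\<^esub> (pr j (c x)) \<otimes>\<^bsub>Qt j\<^esub> pr j s \<otimes>\<^bsub>Qt j\<^esub> pr j (c (x \<otimes> s))"
        using step[OF x, of s] x s c by simp
      also have "\<dots> = inv\<^bsub>Qt j\<^esub> (pr j e \<otimes>\<^bsub>Qt j\<^esub> d x) \<otimes>\<^bsub>Qt j\<^esub> pr j s \<otimes>\<^bsub>Qt j\<^esub> (pr j e \<otimes>\<^bsub>Qt j\<^esub> d (x \<otimes> s))"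
        using x s by (simp add: pc)
      also have "\<dots> = inv\<^bsub>Qt j\<^esub> d x \<otimes>\<^bsub>Qt j\<^esub> inv\<^bsub>Qt j\<^esub> pr j e \<otimes>\<^bsub>Qt j\<^esub> pr j s \<otimes>\<^bsub>Qt j\<^esub> pr j e \<otimes>\<^bsub>Qt j\<^esub> d (x \<otimes> s)"
        using dc s e by (simp add: pr.H.inv_mult_group pr.H.m_assoc)
      finally show "pr j (inv (\<psi> x) \<otimes> \<psi> (x \<otimes> s)) =
          inv\<^bsub>Qt j\<^esub> d x \<otimes>\<^bsub>Qt j\<^esub> inv\<^bsub>Qt j\<^esub> pr j e \<otimes>\<^bsub>Qt j\<^esub> pr j s \<otimes>\<^bsub>Qt j\<^esub> pr j e \<otimes>\<^bsub>Qt j\<^esub> d (x \<otimes> s)" .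
    qed
    then obtain v where v: "v \<in> ser (Suc j)" "\<And>x. x \<in> carrier G \<Longrightarrow> d x = pr j v" by blast
    have vc: "v \<in> carrier G" using v(1) by (rule ser_closed)
    have "inv (e \<otimes> v) \<otimes> c x \<in> ser j" if x: "x \<in> carrier G" for x
    proof -
      have "pr j (e \<otimes> v) = pr j (c x)" using pc[OF x] v(2)[OF x] vc e by simp
      then show ?thesis using pr_eq_iff[of "e \<otimes> v" "c x"] vc e c[OF x] by simp
    qed
    then show ?case using vc e unfolding j_def by blast
  qed
  note const = this
  \<comment> \<open>The descent starts at \<open>n\<close>; if \<open>n < i\<close>, then
    \<open>ser i\<close> is the whole group and \<open>\<one>\<close> serves as the
    constant.\<close>
  have "i \<le> n \<or> n < i" by linarith
  then obtain e where e: "e \<in> carrier G" "\<forall>x\<in>carrier G. inv e \<otimes> c x \<in> ser i"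
  proof
    assume "i \<le> n"
    then show thesis using const[of "n - i"] that by auto
  next
    assume "n < i"
    then have "carrier G \<subseteq> ser i" using upper_central_series_mono[OF torsion_normal, of n i] n by auto
    then show thesis using that[of \<one>] c by auto
  qed
  moreover have "e \<in> ser (Suc i)" using central e by blast
  ultimately show ?thesis unfolding c_def by blast
qed

end

section \<open>Isomorphisms of Cayley graphs\<close>

context fg_nilpotent_group
begin

section \<open>The torsion-free abelian factors of the series\<close>

lemma pr_Suc:
  assumes "x \<in> carrier G" "y \<in> carrier G" "pr i x = pr i y"
  shows "pr (Suc i) x = pr (Suc i) y"
proof -
  have "inv x \<otimes> y \<in> ser i" using assms pr_eq_iff by blast
  then have "inv x \<otimes> y \<in> ser (Suc i)" using ser_subset_Suc by blast
  then show ?thesis using assms(1,2) pr_eq_iff by blast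
qed

lemma pr_absorb:
  assumes "x \<in> carrier G" "k \<in> ser i"
  shows "pr i (x \<otimes> k) = pr i x"
proof -
  have "k \<in> carrier G" "pr i k = \<one>\<^bsub>Qt i\<^esub>" using assms(2) ser_closed pr_eq_one_iff by blast+
  then show ?thesis using assms(1) by simp
qed

text \<open>The factor of two consecutive terms, placed inside \<open>Qt i\<close> so that its
  products agree with those of the quotient.\<close>

definition layer :: "nat \<Rightarrow> 'a set monoid" where
  "layer i = (Qt i)\<lparr>carrier := pr i ` ser (Suc i)\<rparr>"

lemma layer_simps [simp]:
  "carrier (layer i) = pr i ` ser (Suc i)" "x \<otimes>\<^bsub>layer i\<^esub> y = x \<otimes>\<^bsub>Qt i\<^esub> y"
  unfolding layer_def by auto

lemma layer_subset: "z \<in> carrier (layer i) \<Longrightarrow> z \<in> carrier (Qt i)"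
  using ser_closed unfolding layer_simps carrier_Qt by blast

lemma layer_comm_group: "comm_group (layer i)"
proof (rule group.group_comm_groupI)
  have "subgroup (pr i ` ser (Suc i)) (Qt i)"
    by (rule pr.subgroup_img_is_subgroup[OF normal_imp_subgroup[OF ser_normal]])
  then show "group (layer i)"
    unfolding layer_def by (rule subgroup.subgroup_is_group[OF _ pr.H.is_group])
  fix x y assume "x \<in> carrier (layer i)" and y: "y \<in> carrier (layer i)"
  then show "x \<otimes>\<^bsub>layer i\<^esub> y = y \<otimes>\<^bsub>layer i\<^esub> x"
    using pr_central[of x i y] layer_subset[OF y] by simp
qed

text \<open>As \<open>x\<close> and \<open>y\<close> commute, \<open>x y^-1\<close> is a root of the
  identity in a torsion-free group.\<close>

lemma layer_pow_inject:
  assumes x: "x \<in> carrier (layer i)" and y: "y \<in> carrier (layer i)" and n: "n > (0::nat)"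
    and eq: "x [^]\<^bsub>layer i\<^esub> n = y [^]\<^bsub>layer i\<^esub> n"
  shows "x = y"
proof -
  have c: "x \<in> carrier (Qt i)" "y \<in> carrier (Qt i)" using x y layer_subset by blast+
  have pow: "z [^]\<^bsub>layer i\<^esub> n = z [^]\<^bsub>Qt i\<^esub> n" for z
    unfolding layer_def using pr.H.nat_pow_consistent by metis
  have comm: "x \<otimes>\<^bsub>Qt i\<^esub> inv\<^bsub>Qt i\<^esub> y = inv\<^bsub>Qt i\<^esub> y \<otimes>\<^bsub>Qt i\<^esub> x"
    using pr_central[of x i "inv\<^bsub>Qt i\<^esub> y"] x c by simp
  have "(x \<otimes>\<^bsub>Qt i\<^esub> inv\<^bsub>Qt i\<^esub> y) [^]\<^bsub>Qt i\<^esub> n = x [^]\<^bsub>Qt i\<^esub> n \<otimes>\<^bsub>Qt i\<^esub> inv\<^bsub>Qt i\<^esub> y [^]\<^bsub>Qt i\<^esub> n"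
    using c by (intro pr.H.pow_mult_distrib comm) auto
  also have "\<dots> = \<one>\<^bsub>Qt i\<^esub>" using eq c unfolding pow by (simp add: pr.H.nat_pow_inv)
  finally have "x \<otimes>\<^bsub>Qt i\<^esub> inv\<^bsub>Qt i\<^esub> y = \<one>\<^bsub>Qt i\<^esub>"
    by (rule pr_torsion_free[OF _ n, rotated]) (use c in simp)
  then show ?thesis using c by (metis pr.H.inv_closed pr.H.inv_equality pr.H.inv_inv)
qed

end

section \<open>Displacement under translations and compatibility with the series\<close>

locale cayley_iso = G1: fg_nilpotent_group G1 S1 + G2: fg_nilpotent_group G2 S2
  for G1 :: "('a, 'c) monoid_scheme" and S1 :: "'a set"
    and G2 :: "('b, 'd) monoid_scheme" and S2 :: "'b set" +
  fixes \<phi> :: "'a \<Rightarrow> 'b"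
  assumes bij: "bij_betw \<phi> (carrier G1) (carrier G2)"
    and adj: "\<And>x y. x \<in> carrier G1 \<Longrightarrow> y \<in> carrier G1 \<Longrightarrow>
      inv\<^bsub>G1\<^esub> x \<otimes>\<^bsub>G1\<^esub> y \<in> S1 \<longleftrightarrow> inv\<^bsub>G2\<^esub> \<phi> x \<otimes>\<^bsub>G2\<^esub> \<phi> y \<in> S2"
begin

abbreviation \<phi>' :: "'b \<Rightarrow> 'a" where "\<phi>' \<equiv> inv_into (carrier G1) \<phi>"

lemma phi_closed [simp]: "x \<in> carrier G1 \<Longrightarrow> \<phi> x \<in> carrier G2"
  using bij bij_betwE by blast

lemma phi'_closed [simp]: "y \<in> carrier G2 \<Longrightarrow> \<phi>' y \<in> carrier G1"
  using bij_betw_inv_into[OF bij] bij_betwE by blast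

lemma phi_phi' [simp]: "y \<in> carrier G2 \<Longrightarrow> \<phi> (\<phi>' y) = y"
  using bij by (rule bij_betw_inv_into_right)

lemma phi'_phi [simp]: "x \<in> carrier G1 \<Longrightarrow> \<phi>' (\<phi> x) = x"
  using bij by (rule bij_betw_inv_into_left)

lemma inverse_cayley_iso: "cayley_iso G2 S2 G1 S1 \<phi>'"
proof (unfold_locales)
  show "bij_betw \<phi>' (carrier G2) (carrier G1)" using bij by (rule bij_betw_inv_into)
  fix x y assume "x \<in> carrier G2" "y \<in> carrier G2"
  then show "inv\<^bsub>G2\<^esub> x \<otimes>\<^bsub>G2\<^esub> y \<in> S2 \<longleftrightarrow> inv\<^bsub>G1\<^esub> \<phi>' x \<otimes>\<^bsub>G1\<^esub> \<phi>' y \<in> S1"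
    using adj[of "\<phi>' x" "\<phi>' y"] by simp
qed

text \<open>Edges at \<open>x\<close> and at \<open>\<phi> x\<close> are labelled by generators; the
  relabelling may vary with \<open>x\<close>.\<close>

lemma neighbours_bij:
  assumes x: "x \<in> carrier G1"
  shows "bij_betw (\<lambda>s. inv\<^bsub>G2\<^esub> \<phi> x \<otimes>\<^bsub>G2\<^esub> \<phi> (x \<otimes>\<^bsub>G1\<^esub> s)) S1 S2"
proof (rule bij_betw_imageI)
  show "inj_on (\<lambda>s. inv\<^bsub>G2\<^esub> \<phi> x \<otimes>\<^bsub>G2\<^esub> \<phi> (x \<otimes>\<^bsub>G1\<^esub> s)) S1"
  proof (rule inj_onI)
    fix s t assume s: "s \<in> S1" "t \<in> S1"
      and "inv\<^bsub>G2\<^esub> \<phi> x \<otimes>\<^bsub>G2\<^esub> \<phi> (x \<otimes>\<^bsub>G1\<^esub> s) = inv\<^bsub>G2\<^esub> \<phi> x \<otimes>\<^bsub>G2\<^esub> \<phi> (x \<otimes>\<^bsub>G1\<^esub> t)"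
    then have "\<phi> (x \<otimes>\<^bsub>G1\<^esub> s) = \<phi> (x \<otimes>\<^bsub>G1\<^esub> t)" using x by simp
    then have "x \<otimes>\<^bsub>G1\<^esub> s = x \<otimes>\<^bsub>G1\<^esub> t" using x s by (metis G1.S_closed G1.m_closed phi'_phi)
    then show "s = t" using x s by simp
  qed
  show "(\<lambda>s. inv\<^bsub>G2\<^esub> \<phi> x \<otimes>\<^bsub>G2\<^esub> \<phi> (x \<otimes>\<^bsub>G1\<^esub> s)) ` S1 = S2"
  proof (intro equalityI subsetI)
    fix t assume "t \<in> (\<lambda>s. inv\<^bsub>G2\<^esub> \<phi> x \<otimes>\<^bsub>G2\<^esub> \<phi> (x \<otimes>\<^bsub>G1\<^esub> s)) ` S1"
    then obtain s where s: "s \<in> S1" "t = inv\<^bsub>G2\<^esub> \<phi> x \<otimes>\<^bsub>G2\<^esub> \<phi> (x \<otimes>\<^bsub>G1\<^esub> s)" by blast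
    then show "t \<in> S2" using adj[of x "x \<otimes>\<^bsub>G1\<^esub> s"] x by (simp flip: G1.m_assoc)
  next
    fix t assume t: "t \<in> S2"
    define s where "s = inv\<^bsub>G1\<^esub> x \<otimes>\<^bsub>G1\<^esub> \<phi>' (\<phi> x \<otimes>\<^bsub>G2\<^esub> t)"
    have xs: "x \<otimes>\<^bsub>G1\<^esub> s = \<phi>' (\<phi> x \<otimes>\<^bsub>G2\<^esub> t)" unfolding s_def using x t by (simp flip: G1.m_assoc)
    have eq: "inv\<^bsub>G2\<^esub> \<phi> x \<otimes>\<^bsub>G2\<^esub> \<phi> (x \<otimes>\<^bsub>G1\<^esub> s) = t" unfolding xs using x t by (simp flip: G2.m_assoc)
    have "s \<in> carrier G1" unfolding s_def using x t by simp
    then have "s \<in> S1"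
      using adj[of x "x \<otimes>\<^bsub>G1\<^esub> s"] x t eq by (simp flip: G1.m_assoc)
    then show "t \<in> (\<lambda>s. inv\<^bsub>G2\<^esub> \<phi> x \<otimes>\<^bsub>G2\<^esub> \<phi> (x \<otimes>\<^bsub>G1\<^esub> s)) ` S1" using eq by blast
  qed
qed

text \<open>A word for \<open>g\<close> gives a path from \<open>x\<close> to \<open>x g\<close>;
  its image is a path of the same length, so the displacement is a word of that length over the
  finite set \<open>S2\<close>.\<close>

lemma displacement_finite:
  assumes "g \<in> carrier G1"
  shows "\<exists>B. finite B \<and> B \<subseteq> carrier G2 \<and>
    (\<forall>x\<in>carrier G1. inv\<^bsub>G2\<^esub> \<phi> x \<otimes>\<^bsub>G2\<^esub> \<phi> (x \<otimes>\<^bsub>G1\<^esub> g) \<in> B)"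
  using assms
proof (rule G1.induct_right)
  show "\<exists>B. finite B \<and> B \<subseteq> carrier G2 \<and>
    (\<forall>x\<in>carrier G1. inv\<^bsub>G2\<^esub> \<phi> x \<otimes>\<^bsub>G2\<^esub> \<phi> (x \<otimes>\<^bsub>G1\<^esub> \<one>\<^bsub>G1\<^esub>) \<in> B)"
    by (rule exI[of _ "{\<one>\<^bsub>G2\<^esub>}"]) simp
  fix h s assume h: "h \<in> carrier G1" and s: "s \<in> S1"
    and "\<exists>B. finite B \<and> B \<subseteq> carrier G2 \<and>
      (\<forall>x\<in>carrier G1. inv\<^bsub>G2\<^esub> \<phi> x \<otimes>\<^bsub>G2\<^esub> \<phi> (x \<otimes>\<^bsub>G1\<^esub> h) \<in> B)"
  then obtain B where B: "finite B" "B \<subseteq> carrier G2"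
    "\<And>x. x \<in> carrier G1 \<Longrightarrow> inv\<^bsub>G2\<^esub> \<phi> x \<otimes>\<^bsub>G2\<^esub> \<phi> (x \<otimes>\<^bsub>G1\<^esub> h) \<in> B" by blast
  let ?B = "(\<lambda>(b, t). b \<otimes>\<^bsub>G2\<^esub> t) ` (B \<times> S2)"
  show "\<exists>B. finite B \<and> B \<subseteq> carrier G2 \<and>
    (\<forall>x\<in>carrier G1. inv\<^bsub>G2\<^esub> \<phi> x \<otimes>\<^bsub>G2\<^esub> \<phi> (x \<otimes>\<^bsub>G1\<^esub> (h \<otimes>\<^bsub>G1\<^esub> s)) \<in> B)"
  proof (intro exI[of _ ?B] conjI ballI)
    show "finite ?B" using B G2.finite_S by simp
    show "?B \<subseteq> carrier G2" using B(2) by auto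
    fix x assume x: "x \<in> carrier G1"
    have "inv\<^bsub>G2\<^esub> \<phi> (x \<otimes>\<^bsub>G1\<^esub> h) \<otimes>\<^bsub>G2\<^esub> \<phi> (x \<otimes>\<^bsub>G1\<^esub> h \<otimes>\<^bsub>G1\<^esub> s) \<in> S2"
      using neighbours_bij[of "x \<otimes>\<^bsub>G1\<^esub> h"] x h s bij_betwE by fastforce
    moreover have "inv\<^bsub>G2\<^esub> \<phi> x \<otimes>\<^bsub>G2\<^esub> \<phi> (x \<otimes>\<^bsub>G1\<^esub> (h \<otimes>\<^bsub>G1\<^esub> s)) =
        (inv\<^bsub>G2\<^esub> \<phi> x \<otimes>\<^bsub>G2\<^esub> \<phi> (x \<otimes>\<^bsub>G1\<^esub> h)) \<otimes>\<^bsub>G2\<^esub>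
        (inv\<^bsub>G2\<^esub> \<phi> (x \<otimes>\<^bsub>G1\<^esub> h) \<otimes>\<^bsub>G2\<^esub> \<phi> (x \<otimes>\<^bsub>G1\<^esub> h \<otimes>\<^bsub>G1\<^esub> s))"
    proof -
      have c: "\<phi> x \<in> carrier G2" "\<phi> (x \<otimes>\<^bsub>G1\<^esub> h) \<in> carrier G2" "\<phi> (x \<otimes>\<^bsub>G1\<^esub> h \<otimes>\<^bsub>G1\<^esub> s) \<in> carrier G2"
        using x h s by auto
      have "\<phi> (x \<otimes>\<^bsub>G1\<^esub> h) \<otimes>\<^bsub>G2\<^esub> (inv\<^bsub>G2\<^esub> \<phi> (x \<otimes>\<^bsub>G1\<^esub> h) \<otimes>\<^bsub>G2\<^esub> \<phi> (x \<otimes>\<^bsub>G1\<^esub> h \<otimes>\<^bsub>G1\<^esub> s))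
          = \<phi> (x \<otimes>\<^bsub>G1\<^esub> h \<otimes>\<^bsub>G1\<^esub> s)" using c by (simp flip: G2.m_assoc)
      then show ?thesis using c x h s by (simp add: G2.m_assoc G1.m_assoc)
    qed
    ultimately show "inv\<^bsub>G2\<^esub> \<phi> x \<otimes>\<^bsub>G2\<^esub> \<phi> (x \<otimes>\<^bsub>G1\<^esub> (h \<otimes>\<^bsub>G1\<^esub> s)) \<in> ?B"
      using B(3)[OF x] by (auto intro: rev_image_eqI)
  qed
qed

text \<open>Transporting left translation by \<open>g\<close> through \<open>\<phi>\<close> gives an
  automorphism \<open>\<psi>\<close> of the second graph, to which
  \<open>bounded_automorphism_constant\<close> applies.\<close>

lemma translation_constant:
  assumes g: "g \<in> carrier G1" and B: "finite B" "B \<subseteq> carrier G2"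
    "\<And>x. x \<in> carrier G1 \<Longrightarrow> \<exists>b\<in>B. G2.pr i (\<phi> (g \<otimes>\<^bsub>G1\<^esub> x)) = G2.pr i (\<phi> x \<otimes>\<^bsub>G2\<^esub> b)"
  shows "\<exists>e\<in>G2.ser (Suc i). \<forall>x\<in>carrier G1. G2.pr i (\<phi> (g \<otimes>\<^bsub>G1\<^esub> x)) = G2.pr i (\<phi> x \<otimes>\<^bsub>G2\<^esub> e)"
proof -
  define \<psi> where "\<psi> y = \<phi> (g \<otimes>\<^bsub>G1\<^esub> \<phi>' y)" for y
  interpret I: cayley_iso G2 S2 G1 S1 \<phi>' by (rule inverse_cayley_iso)
  have conv: "inv\<^bsub>G2\<^esub> b \<otimes>\<^bsub>G2\<^esub> (inv\<^bsub>G2\<^esub> y \<otimes>\<^bsub>G2\<^esub> z) \<in> G2.ser i \<longleftrightarrow> G2.pr i z = G2.pr i (y \<otimes>\<^bsub>G2\<^esub> b)"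
    if "b \<in> carrier G2" "y \<in> carrier G2" "z \<in> carrier G2" for b y z
    using that G2.pr_eq_iff[of "y \<otimes>\<^bsub>G2\<^esub> b" z i] by (auto simp: G2.inv_mult_group G2.m_assoc)
  have "\<exists>e\<in>G2.ser (Suc i). \<forall>y\<in>carrier G2. inv\<^bsub>G2\<^esub> e \<otimes>\<^bsub>G2\<^esub> (inv\<^bsub>G2\<^esub> y \<otimes>\<^bsub>G2\<^esub> \<psi> y) \<in> G2.ser i"
  proof (rule G2.bounded_automorphism_constant[OF _ _ B(1,2)])
    show "\<psi> \<in> carrier G2 \<rightarrow> carrier G2" unfolding \<psi>_def using g by auto
    fix y assume y: "y \<in> carrier G2"
    \<comment> \<open>The relabelling of \<open>\<psi>\<close> at \<open>y\<close> is that of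
      \<open>\<phi>'\<close> at \<open>y\<close> followed by that of \<open>\<phi>\<close> at the
      translated vertex.\<close>
    have "bij_betw ((\<lambda>s. inv\<^bsub>G2\<^esub> \<phi> (g \<otimes>\<^bsub>G1\<^esub> \<phi>' y) \<otimes>\<^bsub>G2\<^esub> \<phi> (g \<otimes>\<^bsub>G1\<^esub> \<phi>' y \<otimes>\<^bsub>G1\<^esub> s)) \<circ>
        (\<lambda>s. inv\<^bsub>G1\<^esub> \<phi>' y \<otimes>\<^bsub>G1\<^esub> \<phi>' (y \<otimes>\<^bsub>G2\<^esub> s))) S2 S2"
      using g y by (intro bij_betw_trans[OF I.neighbours_bij neighbours_bij]) auto
    then show "bij_betw (\<lambda>s. inv\<^bsub>G2\<^esub> \<psi> y \<otimes>\<^bsub>G2\<^esub> \<psi> (y \<otimes>\<^bsub>G2\<^esub> s)) S2 S2"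
    proof (rule bij_betw_cong[THEN iffD1, rotated])
      fix s assume s: "s \<in> S2"
      have "g \<otimes>\<^bsub>G1\<^esub> \<phi>' y \<otimes>\<^bsub>G1\<^esub> (inv\<^bsub>G1\<^esub> \<phi>' y \<otimes>\<^bsub>G1\<^esub> \<phi>' (y \<otimes>\<^bsub>G2\<^esub> s)) = g \<otimes>\<^bsub>G1\<^esub> \<phi>' (y \<otimes>\<^bsub>G2\<^esub> s)"
        using g y s by (simp add: G1.m_assoc) (simp flip: G1.m_assoc)
      then show "((\<lambda>s. inv\<^bsub>G2\<^esub> \<phi> (g \<otimes>\<^bsub>G1\<^esub> \<phi>' y) \<otimes>\<^bsub>G2\<^esub> \<phi> (g \<otimes>\<^bsub>G1\<^esub> \<phi>' y \<otimes>\<^bsub>G1\<^esub> s)) \<circ>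
        (\<lambda>s. inv\<^bsub>G1\<^esub> \<phi>' y \<otimes>\<^bsub>G1\<^esub> \<phi>' (y \<otimes>\<^bsub>G2\<^esub> s))) s = inv\<^bsub>G2\<^esub> \<psi> y \<otimes>\<^bsub>G2\<^esub> \<psi> (y \<otimes>\<^bsub>G2\<^esub> s)"
        unfolding \<psi>_def comp_def by simp
    qed
  next
    fix y assume y: "y \<in> carrier G2"
    then obtain b where b: "b \<in> B" "G2.pr i (\<phi> (g \<otimes>\<^bsub>G1\<^esub> \<phi>' y)) = G2.pr i (\<phi> (\<phi>' y) \<otimes>\<^bsub>G2\<^esub> b)"
      using B(3) phi'_closed by blast
    have bc: "b \<in> carrier G2" "\<psi> y \<in> carrier G2" using b(1) B(2) g y unfolding \<psi>_def by auto
    then show "\<exists>b\<in>B. inv\<^bsub>G2\<^esub> b \<otimes>\<^bsub>G2\<^esub> (inv\<^bsub>G2\<^esub> y \<otimes>\<^bsub>G2\<^esub> \<psi> y) \<in> G2.ser i"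
      using b y conv[OF bc(1) y bc(2)] unfolding \<psi>_def phi_phi'[OF y] by blast
  qed
  then obtain e where e: "e \<in> G2.ser (Suc i)"
    "\<And>y. y \<in> carrier G2 \<Longrightarrow> inv\<^bsub>G2\<^esub> e \<otimes>\<^bsub>G2\<^esub> (inv\<^bsub>G2\<^esub> y \<otimes>\<^bsub>G2\<^esub> \<psi> y) \<in> G2.ser i" by blast
  have ec: "e \<in> carrier G2" using e(1) by (rule G2.ser_closed)
  have "G2.pr i (\<phi> (g \<otimes>\<^bsub>G1\<^esub> x)) = G2.pr i (\<phi> x \<otimes>\<^bsub>G2\<^esub> e)" if x: "x \<in> carrier G1" for x
  proof -
    have y: "\<phi> x \<in> carrier G2" "\<psi> (\<phi> x) = \<phi> (g \<otimes>\<^bsub>G1\<^esub> x)" using x unfolding \<psi>_def by auto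
    then have "\<psi> (\<phi> x) \<in> carrier G2" using g x by simp
    then show ?thesis using conv[OF ec y(1)] e(2)[OF y(1)] y(2) by simp
  qed
  then show ?thesis using e(1) by blast
qed

lemma pr_displacement:
  assumes "x \<in> carrier G1" "y \<in> carrier G1"
  shows "G2.pr i (\<phi> x \<otimes>\<^bsub>G2\<^esub> (inv\<^bsub>G2\<^esub> \<phi> x \<otimes>\<^bsub>G2\<^esub> \<phi> y)) = G2.pr i (\<phi> y)"
  using assms by (simp flip: G2.pr.H.m_assoc)

text \<open>Left translation by a torsion element is a bounded automorphism of finite order.\<close>

lemma phi_torsion:
  assumes n: "n \<in> G1.tors" and x: "x \<in> carrier G1"
  shows "G2.pr 0 (\<phi> (x \<otimes>\<^bsub>G1\<^esub> n)) = G2.pr 0 (\<phi> x)"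
proof -
  interpret N: normal G1.tors G1 by (rule G1.torsion_normal)
  have "\<forall>n\<in>G1.tors. \<exists>B. finite B \<and> B \<subseteq> carrier G2 \<and>
    (\<forall>x\<in>carrier G1. inv\<^bsub>G2\<^esub> \<phi> x \<otimes>\<^bsub>G2\<^esub> \<phi> (x \<otimes>\<^bsub>G1\<^esub> n) \<in> B)"
    using displacement_finite N.mem_carrier by blast
  then obtain B where B: "\<And>n. n \<in> G1.tors \<Longrightarrow> finite (B n) \<and> B n \<subseteq> carrier G2 \<and>
    (\<forall>x\<in>carrier G1. inv\<^bsub>G2\<^esub> \<phi> x \<otimes>\<^bsub>G2\<^esub> \<phi> (x \<otimes>\<^bsub>G1\<^esub> n) \<in> B n)" by metis
  have left: "G2.pr 0 (\<phi> (g \<otimes>\<^bsub>G1\<^esub> x)) = G2.pr 0 (\<phi> x)" if g: "g \<in> G1.tors" and x: "x \<in> carrier G1" for g x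
  proof -
    have gc: "g \<in> carrier G1" using g by simp
    have "\<exists>e\<in>G2.ser (Suc 0). \<forall>x\<in>carrier G1. G2.pr 0 (\<phi> (g \<otimes>\<^bsub>G1\<^esub> x)) = G2.pr 0 (\<phi> x \<otimes>\<^bsub>G2\<^esub> e)"
    proof (rule translation_constant[OF gc, of "\<Union>n\<in>G1.tors. B n"])
      show "finite (\<Union>n\<in>G1.tors. B n)" using G1.torsion_finite B by blast
      show "(\<Union>n\<in>G1.tors. B n) \<subseteq> carrier G2" using B by blast
      fix x assume x: "x \<in> carrier G1"
      \<comment> \<open>Left translation by \<open>g\<close> at \<open>x\<close> is right
        translation by the conjugate \<open>?k\<close>. Conjugates stay in the finite torsion
        subgroup, so the union of the sets \<open>B n\<close> is a finite bound.\<close>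
      let ?k = "inv\<^bsub>G1\<^esub> x \<otimes>\<^bsub>G1\<^esub> g \<otimes>\<^bsub>G1\<^esub> x"
      have k: "?k \<in> G1.tors" using N.inv_op_closed1[OF x g] .
      have "x \<otimes>\<^bsub>G1\<^esub> ?k = g \<otimes>\<^bsub>G1\<^esub> x" using x gc by (simp flip: G1.m_assoc)
      then have "inv\<^bsub>G2\<^esub> \<phi> x \<otimes>\<^bsub>G2\<^esub> \<phi> (g \<otimes>\<^bsub>G1\<^esub> x) \<in> B ?k" using B[OF k] x by metis
      moreover have "G2.pr 0 (\<phi> (g \<otimes>\<^bsub>G1\<^esub> x)) =
          G2.pr 0 (\<phi> x \<otimes>\<^bsub>G2\<^esub> (inv\<^bsub>G2\<^esub> \<phi> x \<otimes>\<^bsub>G2\<^esub> \<phi> (g \<otimes>\<^bsub>G1\<^esub> x)))"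
        using pr_displacement[of x "g \<otimes>\<^bsub>G1\<^esub> x" 0] x gc by (simp del: G2.pr.hom_mult)
      ultimately show "\<exists>b\<in>\<Union>n\<in>G1.tors. B n. G2.pr 0 (\<phi> (g \<otimes>\<^bsub>G1\<^esub> x)) = G2.pr 0 (\<phi> x \<otimes>\<^bsub>G2\<^esub> b)"
        using k by blast
    qed
    then obtain e where e: "e \<in> G2.ser (Suc 0)"
      "\<And>x. x \<in> carrier G1 \<Longrightarrow> G2.pr 0 (\<phi> (g \<otimes>\<^bsub>G1\<^esub> x)) = G2.pr 0 (\<phi> x \<otimes>\<^bsub>G2\<^esub> e)" by blast
    have ec: "e \<in> carrier G2" using e(1) by (rule G2.ser_closed)
    have pow: "G2.pr 0 (\<phi> (g [^]\<^bsub>G1\<^esub> m \<otimes>\<^bsub>G1\<^esub> x)) = G2.pr 0 (\<phi> x \<otimes>\<^bsub>G2\<^esub> e [^]\<^bsub>G2\<^esub> m)" for m :: nat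
    proof (induct m)
      case (Suc m)
      have "G2.pr 0 (\<phi> (g [^]\<^bsub>G1\<^esub> Suc m \<otimes>\<^bsub>G1\<^esub> x)) = G2.pr 0 (\<phi> (g \<otimes>\<^bsub>G1\<^esub> (g [^]\<^bsub>G1\<^esub> m \<otimes>\<^bsub>G1\<^esub> x)))"
        unfolding G1.nat_pow_Suc2[OF gc] using gc x by (simp add: G1.m_assoc)
      also have "\<dots> = G2.pr 0 (\<phi> (g [^]\<^bsub>G1\<^esub> m \<otimes>\<^bsub>G1\<^esub> x) \<otimes>\<^bsub>G2\<^esub> e)"
        using gc x by (intro e(2)) simp
      also have "\<dots> = G2.pr 0 (\<phi> (g [^]\<^bsub>G1\<^esub> m \<otimes>\<^bsub>G1\<^esub> x)) \<otimes>\<^bsub>G2.Qt 0\<^esub> G2.pr 0 e"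
        using gc x ec by simp
      also have "\<dots> = G2.pr 0 (\<phi> x \<otimes>\<^bsub>G2\<^esub> e [^]\<^bsub>G2\<^esub> Suc m)"
        unfolding Suc using x ec by (simp add: G2.pr.H.m_assoc)
      finally show ?case .
    qed (use x in simp)
    \<comment> \<open>As \<open>g^m = 1\<close>, the power \<open>e^m\<close> is torsion, hence so
      is \<open>e\<close>, and \<open>e\<close> disappears modulo \<open>G2.ser 0\<close>.\<close>
    obtain m :: nat where m: "m > 0" "g [^]\<^bsub>G1\<^esub> m = \<one>\<^bsub>G1\<^esub>"
      using g unfolding torsion_subgroup_def by blast
    have "G2.pr 0 (\<phi> x) \<otimes>\<^bsub>G2.Qt 0\<^esub> G2.pr 0 (e [^]\<^bsub>G2\<^esub> m) = G2.pr 0 (\<phi> x)"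
      using pow[of m] m x ec by simp
    then have "G2.pr 0 (e [^]\<^bsub>G2\<^esub> m) = \<one>\<^bsub>G2.Qt 0\<^esub>" using x ec by simp
    then have "e [^]\<^bsub>G2\<^esub> m \<in> G2.ser 0" using G2.pr_eq_one_iff[of "e [^]\<^bsub>G2\<^esub> m" 0] ec by simp
    then have "e \<in> G2.ser 0" by (rule G2.ser_root[OF ec m(1)])
    then show ?thesis using e(2)[OF x] G2.pr_absorb[of "\<phi> x" e 0] x by simp
  qed
  \<comment> \<open>Right translation by \<open>n\<close> at \<open>x\<close> is left translation by
    the torsion element \<open>x n x^-1\<close>.\<close>
  have "x \<otimes>\<^bsub>G1\<^esub> n \<otimes>\<^bsub>G1\<^esub> inv\<^bsub>G1\<^esub> x \<otimes>\<^bsub>G1\<^esub> x = x \<otimes>\<^bsub>G1\<^esub> n" using n x by (simp add: G1.m_assoc)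
  then show ?thesis using left[OF N.inv_op_closed2[OF x n] x] by simp
qed

text \<open>As \<open>g\<close> is central modulo \<open>G1.ser i\<close>, \<open>g x\<close> and
  \<open>x g\<close> differ by an element that \<open>R\<close> makes invisible. Left translation by
  \<open>g\<close> is therefore bounded modulo \<open>G2.ser i\<close>.\<close>

lemma phi_ser_Suc:
  assumes R: "\<And>x k. x \<in> carrier G1 \<Longrightarrow> k \<in> G1.ser i \<Longrightarrow> G2.pr i (\<phi> (x \<otimes>\<^bsub>G1\<^esub> k)) = G2.pr i (\<phi> x)"
    and g: "g \<in> G1.ser (Suc i)"
  shows "\<exists>e\<in>G2.ser (Suc i). \<forall>x\<in>carrier G1. G2.pr i (\<phi> (x \<otimes>\<^bsub>G1\<^esub> g)) = G2.pr i (\<phi> x \<otimes>\<^bsub>G2\<^esub> e)"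
proof -
  have gc: "g \<in> carrier G1" using g by (rule G1.ser_closed)
  have swap: "G2.pr i (\<phi> (g \<otimes>\<^bsub>G1\<^esub> x)) = G2.pr i (\<phi> (x \<otimes>\<^bsub>G1\<^esub> g))" if x: "x \<in> carrier G1" for x
  proof -
    let ?k = "inv\<^bsub>G1\<^esub> g \<otimes>\<^bsub>G1\<^esub> inv\<^bsub>G1\<^esub> x \<otimes>\<^bsub>G1\<^esub> inv\<^bsub>G1\<^esub> (inv\<^bsub>G1\<^esub> g) \<otimes>\<^bsub>G1\<^esub> inv\<^bsub>G1\<^esub> (inv\<^bsub>G1\<^esub> x)"
    have "inv\<^bsub>G1\<^esub> g \<in> G1.ser (Suc i)"
      by (rule subgroup.m_inv_closed[OF normal_imp_subgroup[OF G1.ser_normal] g])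
    then have "?k \<in> G1.ser i" using x by (intro G1.ser_commutator) auto
    moreover have "x \<otimes>\<^bsub>G1\<^esub> g \<otimes>\<^bsub>G1\<^esub> ?k = g \<otimes>\<^bsub>G1\<^esub> x"
    proof -
      have "x \<otimes>\<^bsub>G1\<^esub> g \<otimes>\<^bsub>G1\<^esub> ?k = (x \<otimes>\<^bsub>G1\<^esub> g) \<otimes>\<^bsub>G1\<^esub> inv\<^bsub>G1\<^esub> (x \<otimes>\<^bsub>G1\<^esub> g) \<otimes>\<^bsub>G1\<^esub> (g \<otimes>\<^bsub>G1\<^esub> x)"
        using x gc by (simp add: G1.m_assoc G1.inv_mult_group)
      then show ?thesis using x gc by simp
    qed
    ultimately show ?thesis using R[of "x \<otimes>\<^bsub>G1\<^esub> g" ?k] x gc by (metis G1.m_closed)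
  qed
  obtain B where B: "finite B" "B \<subseteq> carrier G2"
    "\<forall>x\<in>carrier G1. inv\<^bsub>G2\<^esub> \<phi> x \<otimes>\<^bsub>G2\<^esub> \<phi> (x \<otimes>\<^bsub>G1\<^esub> g) \<in> B" using displacement_finite[OF gc] by blast
  have "\<exists>e\<in>G2.ser (Suc i). \<forall>x\<in>carrier G1. G2.pr i (\<phi> (g \<otimes>\<^bsub>G1\<^esub> x)) = G2.pr i (\<phi> x \<otimes>\<^bsub>G2\<^esub> e)"
  proof (rule translation_constant[OF gc B(1,2)])
    fix x assume x: "x \<in> carrier G1"
    then have "G2.pr i (\<phi> (g \<otimes>\<^bsub>G1\<^esub> x)) = G2.pr i (\<phi> x \<otimes>\<^bsub>G2\<^esub> (inv\<^bsub>G2\<^esub> \<phi> x \<otimes>\<^bsub>G2\<^esub> \<phi> (x \<otimes>\<^bsub>G1\<^esub> g)))"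
      using swap[OF x] pr_displacement[of x "x \<otimes>\<^bsub>G1\<^esub> g" i] gc by (simp del: G2.pr.hom_mult)
    then show "\<exists>b\<in>B. G2.pr i (\<phi> (g \<otimes>\<^bsub>G1\<^esub> x)) = G2.pr i (\<phi> x \<otimes>\<^bsub>G2\<^esub> b)" using B(3) x by blast
  qed
  then show ?thesis using swap by simp
qed

text \<open>The element \<open>e\<close> from \<open>phi_ser_Suc\<close> lies in
  \<open>G2.ser (Suc i)\<close>, so it vanishes one level up; this renews the premise
  \<open>R\<close> there.\<close>

lemma phi_ser:
  assumes "x \<in> carrier G1" "k \<in> G1.ser i"
  shows "G2.pr i (\<phi> (x \<otimes>\<^bsub>G1\<^esub> k)) = G2.pr i (\<phi> x)"
  using assms
proof (induct i arbitrary: x k)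
  case 0
  then show ?case using phi_torsion by simp
next
  case (Suc i)
  have kc: "k \<in> carrier G1" using Suc.prems(2) by (rule G1.ser_closed)
  obtain e where e: "e \<in> G2.ser (Suc i)" "G2.pr i (\<phi> (x \<otimes>\<^bsub>G1\<^esub> k)) = G2.pr i (\<phi> x \<otimes>\<^bsub>G2\<^esub> e)"
    using phi_ser_Suc[OF Suc.hyps Suc.prems(2)] Suc.prems(1) by blast
  have ec: "e \<in> carrier G2" using e(1) by (rule G2.ser_closed)
  have "G2.pr (Suc i) (\<phi> (x \<otimes>\<^bsub>G1\<^esub> k)) = G2.pr (Suc i) (\<phi> x \<otimes>\<^bsub>G2\<^esub> e)"
    using e(2) Suc.prems(1) kc ec by (intro G2.pr_Suc) auto
  also have "\<dots> = G2.pr (Suc i) (\<phi> x)" using Suc.prems(1) by (intro G2.pr_absorb e(1)) simp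
  finally show ?case .
qed

lemma phi_pr:
  assumes "x \<in> carrier G1" "y \<in> carrier G1" "G1.pr i x = G1.pr i y"
  shows "G2.pr i (\<phi> x) = G2.pr i (\<phi> y)"
proof -
  have "inv\<^bsub>G1\<^esub> x \<otimes>\<^bsub>G1\<^esub> y \<in> G1.ser i" using assms G1.pr_eq_iff by blast
  then have "G2.pr i (\<phi> (x \<otimes>\<^bsub>G1\<^esub> (inv\<^bsub>G1\<^esub> x \<otimes>\<^bsub>G1\<^esub> y))) = G2.pr i (\<phi> x)"
    using assms(1) by (intro phi_ser)
  then show ?thesis using assms(1,2) by (simp flip: G1.m_assoc)
qed

text \<open>The reverse implication is \<open>phi_pr\<close> for the inverse isomorphism.\<close>

lemma phi_pr_iff:
  assumes x: "x \<in> carrier G1" and y: "y \<in> carrier G1"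
  shows "G2.pr i (\<phi> x) = G2.pr i (\<phi> y) \<longleftrightarrow> G1.pr i x = G1.pr i y"
proof
  interpret I: cayley_iso G2 S2 G1 S1 \<phi>' by (rule inverse_cayley_iso)
  assume "G2.pr i (\<phi> x) = G2.pr i (\<phi> y)"
  then show "G1.pr i x = G1.pr i y" using I.phi_pr[of "\<phi> x" "\<phi> y" i] x y by simp
qed (use phi_pr assms in blast)

text \<open>For fixed \<open>x\<close>, the elements \<open>\<phi>(x)\<^sup>-\<^sup>1 \<phi>(xs')\<close> with \<open>s'\<close> in the coset of \<open>s\<close> exhaust a set \<open>C\<close> that
  does not depend on \<open>x\<close>. Modulo \<open>G2.ser i\<close>, their product determines a power of \<open>\<phi>(x)\<^sup>-\<^sup>1 \<phi>(xs)\<close>.\<close>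

lemma right_translation_by_generator:
  assumes s: "s \<in> S1" and t0: "t0 \<in> carrier G2"
    and up: "\<And>x. x \<in> carrier G1 \<Longrightarrow> G2.pr (Suc i) (\<phi> (x \<otimes>\<^bsub>G1\<^esub> s)) = G2.pr (Suc i) (\<phi> x \<otimes>\<^bsub>G2\<^esub> t0)"
  shows "\<exists>t\<in>carrier G2. \<forall>x\<in>carrier G1. G2.pr i (\<phi> (x \<otimes>\<^bsub>G1\<^esub> s)) = G2.pr i (\<phi> x \<otimes>\<^bsub>G2\<^esub> t)"
proof -
  have sc: "s \<in> carrier G1" using s by simp
  interpret L: comm_group "G2.layer i" by (rule G2.layer_comm_group)
  \<comment> \<open>\<open>F\<close> collects the generators congruent to \<open>s\<close>, and
    \<open>C\<close> those congruent to \<open>t0\<close>, one level up; by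
    \<open>phi_pr_iff\<close> each \<open>f x\<close> matches them bijectively.\<close>
  define F where "F = {s'\<in>S1. G1.pr (Suc i) s' = G1.pr (Suc i) s}"
  define C where "C = {c\<in>S2. G2.pr (Suc i) c = G2.pr (Suc i) t0}"
  define f where "f x s' = inv\<^bsub>G2\<^esub> \<phi> x \<otimes>\<^bsub>G2\<^esub> \<phi> (x \<otimes>\<^bsub>G1\<^esub> s')" for x s'
  have fc: "f x s' \<in> carrier G2" if "x \<in> carrier G1" "s' \<in> carrier G1" for x s'
    using that unfolding f_def by simp
  have phif: "\<phi> x \<otimes>\<^bsub>G2\<^esub> f x s' = \<phi> (x \<otimes>\<^bsub>G1\<^esub> s')" if "x \<in> carrier G1" "s' \<in> carrier G1" for x s'
    using that unfolding f_def by (simp flip: G2.m_assoc)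
  have F: "finite F" "s \<in> F" "F \<subseteq> S1" unfolding F_def using s G1.finite_S by auto
  have prC: "G2.pr (Suc i) (f x s') = G2.pr (Suc i) t0 \<longleftrightarrow> G1.pr (Suc i) s' = G1.pr (Suc i) s"
    if x: "x \<in> carrier G1" and s': "s' \<in> carrier G1" for x s'
  proof -
    have "G2.pr (Suc i) (f x s') = G2.pr (Suc i) t0 \<longleftrightarrow>
        G2.pr (Suc i) (\<phi> x \<otimes>\<^bsub>G2\<^esub> f x s') = G2.pr (Suc i) (\<phi> x \<otimes>\<^bsub>G2\<^esub> t0)"
      using x t0 fc[OF x s'] by simp
    also have "\<dots> \<longleftrightarrow> G2.pr (Suc i) (\<phi> (x \<otimes>\<^bsub>G1\<^esub> s')) = G2.pr (Suc i) (\<phi> (x \<otimes>\<^bsub>G1\<^esub> s))"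
      unfolding phif[OF x s'] up[OF x] ..
    also have "\<dots> \<longleftrightarrow> G1.pr (Suc i) (x \<otimes>\<^bsub>G1\<^esub> s') = G1.pr (Suc i) (x \<otimes>\<^bsub>G1\<^esub> s)"
      using x s' sc by (intro phi_pr_iff) auto
    also have "\<dots> \<longleftrightarrow> G1.pr (Suc i) s' = G1.pr (Suc i) s" using x s' sc by simp
    finally show ?thesis .
  qed
  have bijf: "bij_betw (f x) F C" if x: "x \<in> carrier G1" for x
  proof -
    have b: "bij_betw (f x) S1 S2" unfolding f_def by (rule neighbours_bij[OF x])
    have "f x ` F = C"
    proof (intro equalityI subsetI)
      fix c assume "c \<in> f x ` F"
      then obtain s' where s': "s' \<in> F" "c = f x s'" by blast
      then have "s' \<in> S1" "G1.pr (Suc i) s' = G1.pr (Suc i) s" unfolding F_def by auto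
      then show "c \<in> C" unfolding C_def s'(2) using prC[OF x] bij_betwE[OF b] by auto
    next
      fix c assume c: "c \<in> C"
      then obtain s' where s': "s' \<in> S1" "c = f x s'"
        using b unfolding C_def bij_betw_def by blast
      then have "s' \<in> F" using c prC[OF x] unfolding C_def F_def by auto
      then show "c \<in> f x ` F" using s' by blast
    qed
    then show ?thesis using b F(3) inj_on_subset unfolding bij_betw_def by blast
  qed
  \<comment> \<open>Since \<open>s^-1 s'\<close> lies in \<open>G1.ser (Suc i)\<close>, the images
    of \<open>x s\<close> and \<open>x s'\<close> differ by a factor that is the same for all
    \<open>x\<close>.\<close>
  have "\<forall>s'\<in>F. \<exists>e\<in>G2.ser (Suc i). \<forall>x\<in>carrier G1. G2.pr i (\<phi> (x \<otimes>\<^bsub>G1\<^esub> s')) = G2.pr i (\<phi> (x \<otimes>\<^bsub>G1\<^esub> s) \<otimes>\<^bsub>G2\<^esub> e)"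
  proof
    fix s' assume s': "s' \<in> F"
    then have s'c: "s' \<in> carrier G1" using F by auto
    let ?q = "inv\<^bsub>G1\<^esub> s \<otimes>\<^bsub>G1\<^esub> s'"
    have "?q \<in> G1.ser (Suc i)"
      using s' G1.pr_eq_iff[OF sc s'c, of "Suc i"] unfolding F_def by (simp del: upper_central_series.simps)
    then obtain e where e: "e \<in> G2.ser (Suc i)"
      "\<forall>x\<in>carrier G1. G2.pr i (\<phi> (x \<otimes>\<^bsub>G1\<^esub> ?q)) = G2.pr i (\<phi> x \<otimes>\<^bsub>G2\<^esub> e)"
      using phi_ser_Suc[OF phi_ser] by blast
    have "G2.pr i (\<phi> (x \<otimes>\<^bsub>G1\<^esub> s')) = G2.pr i (\<phi> (x \<otimes>\<^bsub>G1\<^esub> s) \<otimes>\<^bsub>G2\<^esub> e)" if x: "x \<in> carrier G1" for x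
    proof -
      have "x \<otimes>\<^bsub>G1\<^esub> s \<otimes>\<^bsub>G1\<^esub> ?q = x \<otimes>\<^bsub>G1\<^esub> s'"
        using x sc s'c by (simp add: G1.m_assoc) (simp flip: G1.m_assoc)
      then show ?thesis using e(2) x sc by (metis G1.m_closed)
    qed
    then show "\<exists>e\<in>G2.ser (Suc i). \<forall>x\<in>carrier G1.
        G2.pr i (\<phi> (x \<otimes>\<^bsub>G1\<^esub> s')) = G2.pr i (\<phi> (x \<otimes>\<^bsub>G1\<^esub> s) \<otimes>\<^bsub>G2\<^esub> e)" using e(1) by blast
  qed
  then obtain e where e: "\<And>s'. s' \<in> F \<Longrightarrow> e s' \<in> G2.ser (Suc i)"
    "\<And>s' x. s' \<in> F \<Longrightarrow> x \<in> carrier G1 \<Longrightarrow>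
      G2.pr i (\<phi> (x \<otimes>\<^bsub>G1\<^esub> s')) = G2.pr i (\<phi> (x \<otimes>\<^bsub>G1\<^esub> s) \<otimes>\<^bsub>G2\<^esub> e s')" by metis
  have ec: "e s' \<in> carrier G2" if "s' \<in> F" for s' using e(1)[OF that] by (rule G2.ser_closed)
  \<comment> \<open>Dividing by the fixed \<open>t0\<close> moves \<open>C\<close> into the
    commutative group \<open>layer i\<close>, where products can be formed.\<close>
  define w where "w c = G2.pr i (inv\<^bsub>G2\<^esub> t0 \<otimes>\<^bsub>G2\<^esub> c)" for c
  have wC: "w c \<in> carrier (G2.layer i)" if "c \<in> C" for c
  proof -
    have c: "c \<in> carrier G2" "G2.pr (Suc i) t0 = G2.pr (Suc i) c" using that unfolding C_def by auto
    then have "inv\<^bsub>G2\<^esub> t0 \<otimes>\<^bsub>G2\<^esub> c \<in> G2.ser (Suc i)"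
      using G2.pr_eq_iff[OF t0 c(1), of "Suc i"] by (simp del: upper_central_series.simps)
    then show ?thesis unfolding w_def G2.layer_simps by (rule imageI)
  qed
  define \<epsilon> where "\<epsilon> s' = G2.pr i (e s')" for s'
  have eps: "\<epsilon> \<in> F \<rightarrow> carrier (G2.layer i)" unfolding \<epsilon>_def G2.layer_simps using e(1) by blast
  have fC: "f x s' \<in> C" if "x \<in> carrier G1" "s' \<in> F" for x s'
    using bij_betwE[OF bijf[OF that(1)]] that(2) by blast
  have weq: "w (f x s') = w (f x s) \<otimes>\<^bsub>G2.layer i\<^esub> \<epsilon> s'" if x: "x \<in> carrier G1" and s': "s' \<in> F" for x s'
  proof -
    have s'c: "s' \<in> carrier G1" using s' F by auto
    have "G2.pr i (\<phi> x) \<otimes>\<^bsub>G2.Qt i\<^esub> G2.pr i (f x s') = G2.pr i (\<phi> x \<otimes>\<^bsub>G2\<^esub> f x s')"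
      using x fc[OF x s'c] by simp
    also have "\<dots> = G2.pr i (\<phi> x \<otimes>\<^bsub>G2\<^esub> f x s \<otimes>\<^bsub>G2\<^esub> e s')"
      unfolding phif[OF x s'c] phif[OF x sc] by (rule e(2)[OF s' x])
    also have "\<dots> = G2.pr i (\<phi> x) \<otimes>\<^bsub>G2.Qt i\<^esub> (G2.pr i (f x s) \<otimes>\<^bsub>G2.Qt i\<^esub> \<epsilon> s')"
      unfolding \<epsilon>_def using x fc[OF x sc] ec[OF s'] by (simp add: G2.pr.H.m_assoc)
    finally have "G2.pr i (f x s') = G2.pr i (f x s) \<otimes>\<^bsub>G2.Qt i\<^esub> \<epsilon> s'"
      unfolding \<epsilon>_def using x fc[OF x s'c] fc[OF x sc] ec[OF s'] by simp
    then show ?thesis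
      unfolding w_def \<epsilon>_def using t0 fc[OF x s'c] fc[OF x sc] ec[OF s'] by (simp add: G2.pr.H.m_assoc)
  qed
  let ?P = "finprod (G2.layer i)"
  have eC: "?P \<epsilon> F \<in> carrier (G2.layer i)" using eps by (rule L.finprod_closed)
  have wfC: "w (f x s) \<in> carrier (G2.layer i)" if "x \<in> carrier G1" for x
    using wC fC[OF that F(2)] by blast
  \<comment> \<open>The right-hand side is free of \<open>x\<close>: reindexed along
    \<open>f x\<close>, the product over \<open>C\<close> has the factor \<open>w (f x s)\<close>
    once for each element of \<open>F\<close>.\<close>
  have power: "w (f x s) [^]\<^bsub>G2.layer i\<^esub> card F \<otimes>\<^bsub>G2.layer i\<^esub> ?P \<epsilon> F = ?P w C" if x: "x \<in> carrier G1" for x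
  proof -
    have "?P w C = ?P (\<lambda>s'. w (f x s')) F"
      using L.finprod_reindex[of w "f x" F] bijf[OF x] wC unfolding bij_betw_def by auto
    also have "\<dots> = ?P (\<lambda>s'. w (f x s) \<otimes>\<^bsub>G2.layer i\<^esub> \<epsilon> s') F"
      using weq[OF x] wfC[OF x] eps by (intro L.finprod_cong') (auto simp del: G2.layer_simps)
    also have "\<dots> = ?P (\<lambda>s'. w (f x s)) F \<otimes>\<^bsub>G2.layer i\<^esub> ?P \<epsilon> F"
      using wfC[OF x] eps by (intro L.finprod_multf) auto
    also have "?P (\<lambda>s'. w (f x s)) F = w (f x s) [^]\<^bsub>G2.layer i\<^esub> card F"
      by (rule L.finprod_const[OF wfC[OF x]])
    finally show ?thesis by simp
  qed
  \<comment> \<open>Roots in the layer are unique, and \<open>F\<close> is nonempty since it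
    contains \<open>s\<close>.\<close>
  have const: "w (f x s) = w (f \<one>\<^bsub>G1\<^esub> s)" if x: "x \<in> carrier G1" for x
  proof (rule G2.layer_pow_inject)
    show "card F > 0" using F by (auto simp: card_gt_0_iff)
    have "w (f x s) [^]\<^bsub>G2.layer i\<^esub> card F \<otimes>\<^bsub>G2.layer i\<^esub> ?P \<epsilon> F =
        w (f \<one>\<^bsub>G1\<^esub> s) [^]\<^bsub>G2.layer i\<^esub> card F \<otimes>\<^bsub>G2.layer i\<^esub> ?P \<epsilon> F"
      using power[OF x] power[of "\<one>\<^bsub>G1\<^esub>"] by simp
    then show "w (f x s) [^]\<^bsub>G2.layer i\<^esub> card F = w (f \<one>\<^bsub>G1\<^esub> s) [^]\<^bsub>G2.layer i\<^esub> card F"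
      using wfC[OF x] wfC[of "\<one>\<^bsub>G1\<^esub>"] eC by (simp del: G2.layer_simps)
  qed (use wfC x in auto)
  show ?thesis
  proof (intro bexI[of _ "f \<one>\<^bsub>G1\<^esub> s"] ballI)
    show c1: "f \<one>\<^bsub>G1\<^esub> s \<in> carrier G2" using fc sc by simp
    fix x assume x: "x \<in> carrier G1"
    have "G2.pr i (f x s) = G2.pr i (f \<one>\<^bsub>G1\<^esub> s)"
      using const[OF x] t0 fc[OF x sc] c1 unfolding w_def by simp
    then show "G2.pr i (\<phi> (x \<otimes>\<^bsub>G1\<^esub> s)) = G2.pr i (\<phi> x \<otimes>\<^bsub>G2\<^esub> f \<one>\<^bsub>G1\<^esub> s)"
      using phif[OF x sc] x fc[OF x sc] c1 G2.pr.hom_mult[of "\<phi> x" "f x s" i] by simp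
  qed
qed

text \<open>A descent through the series. At each level uniformity is first refined for generators
  and then extended to words by composing translations.\<close>

lemma right_translation:
  assumes "w \<in> carrier G1"
  shows "\<exists>t\<in>carrier G2. \<forall>x\<in>carrier G1. G2.pr 0 (\<phi> (x \<otimes>\<^bsub>G1\<^esub> w)) = G2.pr 0 (\<phi> x \<otimes>\<^bsub>G2\<^esub> t)"
proof -
  obtain n where n: "G2.ser n = carrier G2" using G2.ser_eq_carrier by blast
  have "l \<le> n \<Longrightarrow> w \<in> carrier G1 \<Longrightarrow> \<exists>t\<in>carrier G2. \<forall>x\<in>carrier G1.
      G2.pr (n - l) (\<phi> (x \<otimes>\<^bsub>G1\<^esub> w)) = G2.pr (n - l) (\<phi> x \<otimes>\<^bsub>G2\<^esub> t)" for l w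
  proof (induct l arbitrary: w)
    case 0
    \<comment> \<open>At the top of the series all elements are congruent, so any \<open>t\<close>
      works.\<close>
    have "G2.pr n a = G2.pr n b" if "a \<in> carrier G2" "b \<in> carrier G2" for a b
      using that G2.pr_eq_iff n by simp
    then show ?case using 0 by (intro bexI[of _ "\<one>\<^bsub>G2\<^esub>"]) auto
  next
    case (Suc l)
    define i where "i = n - Suc l"
    have i: "n - l = Suc i" using Suc.prems unfolding i_def by simp
    have gen: "\<exists>t\<in>carrier G2. \<forall>x\<in>carrier G1. G2.pr i (\<phi> (x \<otimes>\<^bsub>G1\<^esub> s)) = G2.pr i (\<phi> x \<otimes>\<^bsub>G2\<^esub> t)"
      if s: "s \<in> S1" for s
    proof -
      obtain t where "t \<in> carrier G2"
        "\<And>x. x \<in> carrier G1 \<Longrightarrow> G2.pr (Suc i) (\<phi> (x \<otimes>\<^bsub>G1\<^esub> s)) = G2.pr (Suc i) (\<phi> x \<otimes>\<^bsub>G2\<^esub> t)"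
        using Suc.hyps[of s] Suc.prems(1) s unfolding i by auto
      then show ?thesis by (rule right_translation_by_generator[OF s])
    qed
    show ?case unfolding i_def[symmetric] using Suc.prems(2)
    proof (rule G1.induct_right)
      show "\<exists>t\<in>carrier G2. \<forall>x\<in>carrier G1. G2.pr i (\<phi> (x \<otimes>\<^bsub>G1\<^esub> \<one>\<^bsub>G1\<^esub>)) = G2.pr i (\<phi> x \<otimes>\<^bsub>G2\<^esub> t)"
        by (rule bexI[of _ "\<one>\<^bsub>G2\<^esub>"]) auto
      fix h s assume h: "h \<in> carrier G1" and s: "s \<in> S1"
        and "\<exists>t\<in>carrier G2. \<forall>x\<in>carrier G1. G2.pr i (\<phi> (x \<otimes>\<^bsub>G1\<^esub> h)) = G2.pr i (\<phi> x \<otimes>\<^bsub>G2\<^esub> t)"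
      then obtain t where t: "t \<in> carrier G2"
        "\<And>x. x \<in> carrier G1 \<Longrightarrow> G2.pr i (\<phi> (x \<otimes>\<^bsub>G1\<^esub> h)) = G2.pr i (\<phi> x \<otimes>\<^bsub>G2\<^esub> t)" by blast
      obtain u where u: "u \<in> carrier G2"
        "\<And>x. x \<in> carrier G1 \<Longrightarrow> G2.pr i (\<phi> (x \<otimes>\<^bsub>G1\<^esub> s)) = G2.pr i (\<phi> x \<otimes>\<^bsub>G2\<^esub> u)" using gen[OF s] by blast
      have "G2.pr i (\<phi> (x \<otimes>\<^bsub>G1\<^esub> (h \<otimes>\<^bsub>G1\<^esub> s))) = G2.pr i (\<phi> x \<otimes>\<^bsub>G2\<^esub> (t \<otimes>\<^bsub>G2\<^esub> u))" if x: "x \<in> carrier G1" for x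
      proof -
        have "G2.pr i (\<phi> (x \<otimes>\<^bsub>G1\<^esub> (h \<otimes>\<^bsub>G1\<^esub> s))) = G2.pr i (\<phi> (x \<otimes>\<^bsub>G1\<^esub> h)) \<otimes>\<^bsub>G2.Qt i\<^esub> G2.pr i u"
          using u(2)[of "x \<otimes>\<^bsub>G1\<^esub> h"] x h s u(1) by (simp add: G1.m_assoc)
        then show ?thesis using t x u(1) by (simp add: G2.pr.H.m_assoc)
      qed
      then show "\<exists>t\<in>carrier G2. \<forall>x\<in>carrier G1.
          G2.pr i (\<phi> (x \<otimes>\<^bsub>G1\<^esub> (h \<otimes>\<^bsub>G1\<^esub> s))) = G2.pr i (\<phi> x \<otimes>\<^bsub>G2\<^esub> t)"
        using t(1) u(1) by (intro bexI[of _ "t \<otimes>\<^bsub>G2\<^esub> u"]) auto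
    qed
  qed
  from this[of n w] show ?thesis using assms by simp
qed

text \<open>Evaluating the right translation by \<open>y\<close> at \<open>\<one>\<close> identifies
  \<open>t\<close> as \<open>\<phi>(1)^-1 \<phi>(y)\<close>.\<close>

lemma phi_mult:
  assumes x: "x \<in> carrier G1" and y: "y \<in> carrier G1"
  shows "G2.pr 0 (\<phi> (x \<otimes>\<^bsub>G1\<^esub> y)) =
    G2.pr 0 (\<phi> x) \<otimes>\<^bsub>G2.Qt 0\<^esub> inv\<^bsub>G2.Qt 0\<^esub> G2.pr 0 (\<phi> \<one>\<^bsub>G1\<^esub>) \<otimes>\<^bsub>G2.Qt 0\<^esub> G2.pr 0 (\<phi> y)"
proof -
  obtain t where t: "t \<in> carrier G2"
    "\<And>x. x \<in> carrier G1 \<Longrightarrow> G2.pr 0 (\<phi> (x \<otimes>\<^bsub>G1\<^esub> y)) = G2.pr 0 (\<phi> x \<otimes>\<^bsub>G2\<^esub> t)"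
    using right_translation[OF y] by blast
  have "G2.pr 0 (\<phi> y) = G2.pr 0 (\<phi> \<one>\<^bsub>G1\<^esub>) \<otimes>\<^bsub>G2.Qt 0\<^esub> G2.pr 0 t"
    using t(2)[of "\<one>\<^bsub>G1\<^esub>"] t(1) y by simp
  then have "G2.pr 0 t = inv\<^bsub>G2.Qt 0\<^esub> G2.pr 0 (\<phi> \<one>\<^bsub>G1\<^esub>) \<otimes>\<^bsub>G2.Qt 0\<^esub> G2.pr 0 (\<phi> y)"
    using t(1) y by (simp flip: G2.pr.H.m_assoc)
  then show ?thesis using t(2)[OF x] t(1) x y by (simp add: G2.pr.H.m_assoc)
qed

lemma induces_affine_bijection:
  "\<exists>\<psi> :: 'a set \<Rightarrow> 'b set.
    (\<forall>x \<in> carrier G1. \<psi> (G1.pr 0 x) = G2.pr 0 (\<phi> x)) \<and> affine_bijection (G1.Qt 0) (G2.Qt 0) \<psi>"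
proof -
  \<comment> \<open>The representative is arbitrary; \<open>phi_pr\<close> shows that the value does
    not depend on it.\<close>
  define \<psi> where "\<psi> X = G2.pr 0 (\<phi> (SOME x. x \<in> carrier G1 \<and> G1.pr 0 x = X))" for X
  have psi: "\<psi> (G1.pr 0 x) = G2.pr 0 (\<phi> x)" if x: "x \<in> carrier G1" for x
  proof -
    have "(SOME y. y \<in> carrier G1 \<and> G1.pr 0 y = G1.pr 0 x) \<in> carrier G1 \<and>
        G1.pr 0 (SOME y. y \<in> carrier G1 \<and> G1.pr 0 y = G1.pr 0 x) = G1.pr 0 x"
      by (rule someI[of _ x]) (use x in simp)
    then show ?thesis unfolding \<psi>_def using phi_pr x by blast
  qed
  define h where "h = G2.pr 0 (\<phi> \<one>\<^bsub>G1\<^esub>)"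
  have h: "h \<in> carrier (G2.Qt 0)" unfolding h_def by simp
  \<comment> \<open>Dividing by the value at the identity leaves the linear part, which is
    multiplicative by \<open>phi_mult\<close>.\<close>
  define \<alpha> where "\<alpha> X = inv\<^bsub>G2.Qt 0\<^esub> h \<otimes>\<^bsub>G2.Qt 0\<^esub> \<psi> X" for X
  have alpha: "\<alpha> (G1.pr 0 x) = inv\<^bsub>G2.Qt 0\<^esub> h \<otimes>\<^bsub>G2.Qt 0\<^esub> G2.pr 0 (\<phi> x)" if "x \<in> carrier G1" for x
    unfolding \<alpha>_def using psi[OF that] by simp
  have "\<alpha> \<in> iso (G1.Qt 0) (G2.Qt 0)"
  proof (rule isoI)
    show "\<alpha> \<in> hom (G1.Qt 0) (G2.Qt 0)"
    proof (rule homI)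
      fix X assume "X \<in> carrier (G1.Qt 0)"
      then show "\<alpha> X \<in> carrier (G2.Qt 0)" unfolding G1.carrier_Qt using alpha h by auto
    next
      fix X Y assume "X \<in> carrier (G1.Qt 0)" "Y \<in> carrier (G1.Qt 0)"
      then obtain x y where x: "x \<in> carrier G1" "X = G1.pr 0 x" and y: "y \<in> carrier G1" "Y = G1.pr 0 y"
        unfolding G1.carrier_Qt by blast
      have "X \<otimes>\<^bsub>G1.Qt 0\<^esub> Y = G1.pr 0 (x \<otimes>\<^bsub>G1\<^esub> y)" using x y by simp
      then show "\<alpha> (X \<otimes>\<^bsub>G1.Qt 0\<^esub> Y) = \<alpha> X \<otimes>\<^bsub>G2.Qt 0\<^esub> \<alpha> Y"
        using alpha[of "x \<otimes>\<^bsub>G1\<^esub> y"] alpha[OF x(1)] alpha[OF y(1)] phi_mult[OF x(1) y(1)] x y h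
        by (simp add: G2.pr.H.m_assoc h_def)
    qed
    show "bij_betw \<alpha> (carrier (G1.Qt 0)) (carrier (G2.Qt 0))"
    proof (rule bij_betw_imageI)
      show "inj_on \<alpha> (carrier (G1.Qt 0))"
      proof (rule inj_onI)
        fix X Y assume "X \<in> carrier (G1.Qt 0)" "Y \<in> carrier (G1.Qt 0)" and eq: "\<alpha> X = \<alpha> Y"
        then obtain x y where x: "x \<in> carrier G1" "X = G1.pr 0 x" and y: "y \<in> carrier G1" "Y = G1.pr 0 y"
          unfolding G1.carrier_Qt by blast
        have "G2.pr 0 (\<phi> x) = G2.pr 0 (\<phi> y)"
          using eq alpha[OF x(1)] alpha[OF y(1)] x y h by simp
        then show "X = Y" using phi_pr_iff x y by simp
      qed
      show "\<alpha> ` carrier (G1.Qt 0) = carrier (G2.Qt 0)"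
      proof (intro equalityI subsetI)
        fix Z assume "Z \<in> \<alpha> ` carrier (G1.Qt 0)"
        then show "Z \<in> carrier (G2.Qt 0)" unfolding G1.carrier_Qt using alpha h by auto
      next
        fix Z assume Z: "Z \<in> carrier (G2.Qt 0)"
        \<comment> \<open>Because \<open>\<alpha>\<close> divides by \<open>h\<close>, the coset to
          be pulled back through \<open>\<phi>'\<close> is \<open>h Z\<close>.\<close>
        then have "h \<otimes>\<^bsub>G2.Qt 0\<^esub> Z \<in> carrier (G2.Qt 0)" using h by simp
        then obtain z where z: "z \<in> carrier G2" "h \<otimes>\<^bsub>G2.Qt 0\<^esub> Z = G2.pr 0 z"
          unfolding G2.carrier_Qt by blast
        have "\<alpha> (G1.pr 0 (\<phi>' z)) = inv\<^bsub>G2.Qt 0\<^esub> h \<otimes>\<^bsub>G2.Qt 0\<^esub> (h \<otimes>\<^bsub>G2.Qt 0\<^esub> Z)"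
          using alpha[of "\<phi>' z"] z by simp
        also have "\<dots> = Z" using h Z by (simp flip: G2.pr.H.m_assoc)
        finally show "Z \<in> \<alpha> ` carrier (G1.Qt 0)"
          using z(1) G1.pr.hom_closed phi'_closed by blast
      qed
    qed
  qed
  moreover have "\<psi> X = h \<otimes>\<^bsub>G2.Qt 0\<^esub> \<alpha> X" if "X \<in> carrier (G1.Qt 0)" for X
  proof -
    have "\<psi> X \<in> carrier (G2.Qt 0)" using that psi unfolding G1.carrier_Qt by auto
    then show ?thesis unfolding \<alpha>_def using h by (simp flip: G2.pr.H.m_assoc)
  qed
  ultimately have "affine_bijection (G1.Qt 0) (G2.Qt 0) \<psi>"
    unfolding affine_bijection_def using h by blast
  then show ?thesis using psi by blast
qed

end

section \<open>From the graph encoding to the locale\<close>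

lemma parcs_Cay_iff:
  assumes "group G" "S \<subseteq> carrier G" "u \<in> carrier G" "v \<in> carrier G"
  shows "(u, v) \<in> parcs (Cay G S) \<longleftrightarrow> inv\<^bsub>G\<^esub> u \<otimes>\<^bsub>G\<^esub> v \<in> S"
proof -
  interpret group G by fact
  have "(u, v) \<in> parcs (Cay G S) \<longleftrightarrow> (\<exists>s\<in>S. v = u \<otimes>\<^bsub>G\<^esub> s)"
    unfolding Cay_def using assms(3) by auto
  also have "\<dots> \<longleftrightarrow> inv\<^bsub>G\<^esub> u \<otimes>\<^bsub>G\<^esub> v \<in> S"
  proof
    assume "\<exists>s\<in>S. v = u \<otimes>\<^bsub>G\<^esub> s"
    then obtain s where s: "s \<in> S" "v = u \<otimes>\<^bsub>G\<^esub> s" by blast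
    then have "s \<in> carrier G" using assms(2) by blast
    then show "inv\<^bsub>G\<^esub> u \<otimes>\<^bsub>G\<^esub> v \<in> S" using s assms(3) by (simp flip: m_assoc)
  next
    assume "inv\<^bsub>G\<^esub> u \<otimes>\<^bsub>G\<^esub> v \<in> S"
    moreover have "v = u \<otimes>\<^bsub>G\<^esub> (inv\<^bsub>G\<^esub> u \<otimes>\<^bsub>G\<^esub> v)" using assms(3,4) by (simp flip: m_assoc)
    ultimately show "\<exists>s\<in>S. v = u \<otimes>\<^bsub>G\<^esub> s" by blast
  qed
  finally show ?thesis .
qed

theorem theorem1p11:
  fixes G1 :: "('a, 'c) monoid_scheme" and G2 :: "('b, 'd) monoid_scheme"
    and S1 :: "'a set" and S2 :: "'b set"
    and N1 :: "'a set" and N2 :: "'b set"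
    and \<phi> :: "'a \<Rightarrow> 'b"
  assumes "nilpotent_group G1" and "nilpotent_group G2"
    and "symmetric_finite_generating_set G1 S1" and "symmetric_finite_generating_set G2 S2"
    and "N1 = torsion_subgroup G1" and "N2 = torsion_subgroup G2"
    and "graph_isomorphism (Cay G1 S1) (Cay G2 S2) \<phi>"
  shows "finite N1 \<and> N1 \<lhd> G1 \<and> finite N2 \<and> N2 \<lhd> G2 \<and>
    (\<exists>\<psi> :: 'a set \<Rightarrow> 'b set.
       (\<forall>x \<in> carrier G1. \<psi> (x <#\<^bsub>G1\<^esub> N1) = \<phi> x <#\<^bsub>G2\<^esub> N2) \<and>
       affine_bijection (G1 Mod N1) (G2 Mod N2) \<psi>)"
proof -
  have 1: "fg_nilpotent_group G1 S1" and 2: "fg_nilpotent_group G2 S2"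
    using assms(1-4) unfolding nilpotent_group_def fg_nilpotent_group_def fg_nilpotent_group_axioms_def
    by auto
  interpret G1: fg_nilpotent_group G1 S1 by (rule 1)
  interpret G2: fg_nilpotent_group G2 S2 by (rule 2)
  have ver: "pverts (Cay G1 S1) = carrier G1" "pverts (Cay G2 S2) = carrier G2"
    unfolding Cay_def by simp_all
  have bij: "bij_betw \<phi> (carrier G1) (carrier G2)"
    using assms(7) unfolding graph_isomorphism_def ver by blast
  interpret cayley_iso G1 S1 G2 S2 \<phi>
  proof unfold_locales
    show "bij_betw \<phi> (carrier G1) (carrier G2)" by (rule bij)
    fix x y assume x: "x \<in> carrier G1" and y: "y \<in> carrier G1"
    then have "(x, y) \<in> parcs (Cay G1 S1) \<longleftrightarrow> (\<phi> x, \<phi> y) \<in> parcs (Cay G2 S2)"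
      using assms(7) unfolding graph_isomorphism_def ver by blast
    moreover have "\<phi> x \<in> carrier G2" "\<phi> y \<in> carrier G2" using bij x y bij_betwE by blast+
    ultimately show "inv\<^bsub>G1\<^esub> x \<otimes>\<^bsub>G1\<^esub> y \<in> S1 \<longleftrightarrow> inv\<^bsub>G2\<^esub> \<phi> x \<otimes>\<^bsub>G2\<^esub> \<phi> y \<in> S2"
      using x y parcs_Cay_iff[OF G1.is_group G1.S_subset] parcs_Cay_iff[OF G2.is_group G2.S_subset]
      by blast
  qed
  \<comment> \<open>The claim is about left cosets and \<open>pr\<close> about right cosets;
    normality identifies them.\<close>
  have "x <#\<^bsub>G1\<^esub> N1 = G1.pr 0 x" if "x \<in> carrier G1" for x
    using normal.coset_eq[OF G1.torsion_normal] that unfolding G1.pr_def assms(5) by simp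
  moreover have "x <#\<^bsub>G2\<^esub> N2 = G2.pr 0 x" if "x \<in> carrier G2" for x
    using normal.coset_eq[OF G2.torsion_normal] that unfolding G2.pr_def assms(6) by simp
  moreover have "G1 Mod N1 = G1.Qt 0" "G2 Mod N2 = G2.Qt 0"
    unfolding G1.Qt_def G2.Qt_def assms(5,6) by simp_all
  ultimately show ?thesis
    using induces_affine_bijection G1.torsion_finite G1.torsion_normal G2.torsion_finite G2.torsion_normal
    unfolding assms(5,6) by simp
qed

end
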